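(* Let $n\ge3$, $a>0$, $1/2<\sigma<4(n-2)^2$, and let $H=-\Delta+V$ be self-adjoint on $L^2(\mathbb{R}^n)$ with real $C^1$ potential $V$. Suppose that for some $0<\lambda<1$, $$ \lambda\Big(4-\frac{\sigma}{(n-2)^2}\Big)\langle x\rangle^{-\sigma}(-\Delta)\langle x\rangle^{-\sigma}-2f(r)\Big(\frac{x}{r}\cdot\nabla V(x)\Big)\ \ge\ 0 $$ in the sense of forms, where $r=|x|$. Then $i[H,\gamma_0]$ is positive and $$ i[H,\gamma_0]\ \ge\ (1-\lambda)\Big(4-\frac{\sigma}{(n-2)^2}\Big)\langle x\rangle^{-\sigma}(-\Delta)\langle x\rangle^{-\sigma}. $$ In particular, the same conclusion holds if for some $0<\lambda<1$ the pointwise condition $$ \lambda\Big((n-2)^2-\frac{\sigma}{4}\Big)\frac{1}{r^2\langle x\rangle^{2\sigma}}-2\frac{M_\sigma}{\sqrt a}|\nabla V(x)|\ \ge\ 0 $$ holds for all $x\ne0$.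
   Context: $\langle x\rangle=(1+a|x|^2)^{1/2}$; $g(r)=(1+ar^2)^{-\sigma/2}$; $f(r)=\int_0^rg^2(s)\,ds$; $M_\sigma=\int_0^\infty(1+s^2)^{-\sigma}ds$; $F(x)=\int_0^{|x|}f(t)\,dt$; $\gamma_0=i[-\Delta,F]=-i(\nabla\cdot\nabla F+\nabla F\cdot\nabla)$. Commutators and operator inequalities are in the sense of quadratic forms. *)

theory Defs
  imports "HOL-Analysis.Analysis"
begin

definition pd :: "'n::finite \<Rightarrow> (real^'n \<Rightarrow> 'b::real_normed_vector) \<Rightarrow> real^'n \<Rightarrow> 'b" where
  "pd j u x = frechet_derivative u (at x) (axis j 1)"

definition pds :: "'n::finite list \<Rightarrow> (real^'n \<Rightarrow> 'b::real_normed_vector) \<Rightarrow> real^'n \<Rightarrow> 'b" where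
  "pds js u = foldr pd js u"

definition smooth :: "(real^'n::finite \<Rightarrow> 'b::real_normed_vector) \<Rightarrow> bool" where
  "smooth u \<longleftrightarrow> (\<forall>js x. pds js u differentiable (at x))"

definition test_fun :: "(real^'n::finite \<Rightarrow> complex) \<Rightarrow> bool" where
  "test_fun u \<longleftrightarrow> smooth u \<and> compact (closure {x. u x \<noteq> 0})"

definition laplace :: "(real^'n::finite \<Rightarrow> 'b::real_normed_vector) \<Rightarrow> real^'n \<Rightarrow> 'b" where
  "laplace u x = (\<Sum>j\<in>UNIV. pd j (pd j u) x)"

definition l2inner :: "(real^'n::finite \<Rightarrow> complex) \<Rightarrow> (real^'n \<Rightarrow> complex) \<Rightarrow> complex" where
  "l2inner v w = (LINT x|lborel. cnj (v x) * w x)"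

definition jbr :: "real \<Rightarrow> real^'n::finite \<Rightarrow> real" where
  "jbr a x = sqrt (1 + a * (norm x)\<^sup>2)"

definition gfun :: "real \<Rightarrow> real \<Rightarrow> real \<Rightarrow> real" where
  "gfun a \<sigma> r = (1 + a * r\<^sup>2) powr (- \<sigma> / 2)"

definition ffun :: "real \<Rightarrow> real \<Rightarrow> real \<Rightarrow> real" where
  "ffun a \<sigma> r = integral {0..r} (\<lambda>s. (gfun a \<sigma> s)\<^sup>2)"

definition Msig :: "real \<Rightarrow> real" where
  "Msig \<sigma> = (LBINT s:{0..}. (1 + s\<^sup>2) powr (- \<sigma>))"

definition Ffun :: "real \<Rightarrow> real \<Rightarrow> real^'n::finite \<Rightarrow> real" where
  "Ffun a \<sigma> x = integral {0..norm x} (ffun a \<sigma>)"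

definition Hop :: "(real^'n::finite \<Rightarrow> real) \<Rightarrow> (real^'n \<Rightarrow> complex) \<Rightarrow> real^'n \<Rightarrow> complex" where
  "Hop V u x = - laplace u x + complex_of_real (V x) * u x"

definition gamma0 :: "real \<Rightarrow> real \<Rightarrow> (real^'n::finite \<Rightarrow> complex) \<Rightarrow> real^'n \<Rightarrow> complex" where
  "gamma0 a \<sigma> u x = - \<i> * (\<Sum>j\<in>UNIV.
      pd j (\<lambda>y. complex_of_real (pd j (Ffun a \<sigma>) y) * u y) x
      + complex_of_real (pd j (Ffun a \<sigma>) x) * pd j u x)"

text \<open>Quadratic form of i[H,gamma_0] on u: <u, i(H gamma0 - gamma0 H) u> = i(<Hu,gamma0 u> - <gamma0 u,Hu>)
  (a real number; we take the real part).\<close>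
definition comm_form :: "real \<Rightarrow> real \<Rightarrow> (real^'n::finite \<Rightarrow> real) \<Rightarrow> (real^'n \<Rightarrow> complex) \<Rightarrow> real" where
  "comm_form a \<sigma> V u = Re (\<i> * (l2inner (Hop V u) (gamma0 a \<sigma> u) - l2inner (gamma0 a \<sigma> u) (Hop V u)))"

definition weighted_form :: "real \<Rightarrow> real \<Rightarrow> (real^'n::finite \<Rightarrow> complex) \<Rightarrow> real" where
  "weighted_form a \<sigma> u = (let w = (\<lambda>x. complex_of_real (jbr a x powr (- \<sigma>)) * u x)
     in Re (l2inner w (\<lambda>x. - laplace w x)))"

definition radial_dV :: "(real^'n::finite \<Rightarrow> real) \<Rightarrow> real^'n \<Rightarrow> real" where
  "radial_dV V x = (\<Sum>j\<in>UNIV. (x $ j / norm x) * pd j V x)"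

definition norm_grad :: "(real^'n::finite \<Rightarrow> real) \<Rightarrow> real^'n \<Rightarrow> real" where
  "norm_grad V x = sqrt (\<Sum>j\<in>UNIV. (pd j V x)\<^sup>2)"

definition mult_form :: "(real^'n::finite \<Rightarrow> real) \<Rightarrow> (real^'n \<Rightarrow> complex) \<Rightarrow> real" where
  "mult_form W u = (LINT x|lborel. W x * (cmod (u x))\<^sup>2)"

definition C1_pot :: "(real^'n::finite \<Rightarrow> real) \<Rightarrow> bool" where
  "C1_pot V \<longleftrightarrow> (\<forall>x. V differentiable (at x)) \<and> (\<forall>j. continuous_on UNIV (pd j V))"

end

theory Submission
  imports Defs
begin

text \<open>
  Write \<open>s = |x|\<^sup>2\<close>, \<open>g = \<langle>x\<rangle>\<^bsup>-\<sigma>\<^esup>\<close> and \<open>K(s) = f(r)/r = \<integral>\<^sub>0\<^sup>1 (1 + a s t\<^sup>2)\<^bsup>-\<sigma>\<^esup> dt\<close>, so that \<open>\<nabla>F = K x\<close> is smooth at the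
  origin. Integrating by parts, the form of the commutator at \<open>u\<close> is
  \<open>\<integral> 4 F\<^sub>j\<^sub>k u\<^sub>j u\<^sub>k - \<Delta>\<^sup>2F |u|\<^sup>2 - 2 f \<partial>\<^sub>rV |u|\<^sup>2\<close>. As \<open>K + 2 s K' = g\<^sup>2\<close> and \<open>K' \<le> 0\<close>, the Hessian of \<open>F\<close> is
  bounded below by \<open>g\<^sup>2\<close>, and \<open>\<integral> g\<^sup>2 |\<nabla>u|\<^sup>2 = \<integral> |\<nabla>(g u)|\<^sup>2 + \<integral> g \<Delta>g |u|\<^sup>2\<close>. The remaining potential satisfies
  \<open>4 g \<Delta>g - \<Delta>\<^sup>2F \<ge> - (\<sigma>/4) g\<^sup>2 / r\<^sup>2\<close>, which Hardy's inequality for \<open>g u\<close> absorbs into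
  \<open>\<sigma>/(n-2)\<^sup>2 \<integral> |\<nabla>(g u)|\<^sup>2\<close>. The pointwise condition implies the form condition by Hardy's inequality
  again, together with \<open>f \<le> M\<^sub>\<sigma> / \<surd>a\<close>.
\<close>

section \<open>Partial derivatives of continuously differentiable functions\<close>

text \<open>Polymorphic in the codomain, so that one calculus serves real coefficients and complex
  test functions; on real-valued functions it agrees with \<open>C1_pot\<close>.\<close>

definition C1 :: "(real^'n::finite \<Rightarrow> 'b::real_normed_vector) \<Rightarrow> bool" where
  "C1 \<phi> \<longleftrightarrow> (\<forall>x. \<phi> differentiable (at x)) \<and> (\<forall>j. continuous_on UNIV (pd j \<phi>))"

definition C2 :: "(real^'n::finite \<Rightarrow> 'b::real_normed_vector) \<Rightarrow> bool" where
  "C2 \<phi> \<longleftrightarrow> C1 \<phi> \<and> (\<forall>j. C1 (pd j \<phi>))"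

lemma pd_eqI: "(\<phi> has_derivative D) (at x) \<Longrightarrow> pd j \<phi> x = D (axis j 1)"
  unfolding pd_def by (metis frechet_derivative_at)

lemma C1I:
  assumes "\<And>x. (\<phi> has_derivative D x) (at x)"
    and "\<And>j. continuous_on UNIV (\<lambda>x. D x (axis j 1))"
  shows "C1 \<phi>"
proof -
  have "pd j \<phi> = (\<lambda>x. D x (axis j 1))" for j
    by (rule ext) (rule pd_eqI[OF assms(1)])
  then show ?thesis
    using assms by (auto simp: C1_def differentiable_def)
qed

lemma C1_has_derivative: "C1 \<phi> \<Longrightarrow> (\<phi> has_derivative frechet_derivative \<phi> (at x)) (at x)"
  by (simp add: C1_def frechet_derivative_works)

lemma C1_continuous: "C1 \<phi> \<Longrightarrow> continuous_on UNIV \<phi>"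
  by (simp add: C1_def continuous_at_imp_continuous_on differentiable_imp_continuous_within)

lemma C1_continuous_pd: "C1 \<phi> \<Longrightarrow> continuous_on UNIV (pd j \<phi>)"
  by (simp add: C1_def)

lemma C2_C1: "C2 \<phi> \<Longrightarrow> C1 \<phi>" and C2_C1_pd: "C2 \<phi> \<Longrightarrow> C1 (pd j \<phi>)"
  by (simp_all add: C2_def)

lemma C2_continuous_pd_pd: "C2 \<phi> \<Longrightarrow> continuous_on UNIV (pd j (pd k \<phi>))"
  by (simp add: C2_C1_pd C1_continuous_pd)

section \<open>Rules for constants, coordinates, sums and products\<close>

lemma C1_const: "C1 (\<lambda>x. c)" and pd_const: "pd j (\<lambda>x. c) = (\<lambda>x. 0)"
  by (rule C1I[where D="\<lambda>x h. 0"], auto intro!: ext pd_eqI[of _ "\<lambda>h. 0", simplified])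

lemma C1_coord: "C1 (\<lambda>x. x $ i)"
  by (rule C1I[where D="\<lambda>x h. h $ i"]) (auto intro: bounded_linear_imp_has_derivative bounded_linear_vec_nth)

lemma pd_coord: "pd j (\<lambda>x. x $ i) = (\<lambda>x. if i = j then 1 else 0)"
  by (rule ext, subst pd_eqI[OF bounded_linear_imp_has_derivative[OF bounded_linear_vec_nth]])
     (simp add: axis_def)

lemma C1_add: "C1 \<phi> \<Longrightarrow> C1 \<psi> \<Longrightarrow> C1 (\<lambda>x. \<phi> x + \<psi> x)"
  by (rule C1I[OF has_derivative_add[OF C1_has_derivative C1_has_derivative]])
     (auto intro!: continuous_intros simp: C1_def pd_def[abs_def])

lemma pd_add: "C1 \<phi> \<Longrightarrow> C1 \<psi> \<Longrightarrow> pd j (\<lambda>x. \<phi> x + \<psi> x) = (\<lambda>x. pd j \<phi> x + pd j \<psi> x)"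
  by (rule ext, subst pd_eqI[OF has_derivative_add[OF C1_has_derivative C1_has_derivative]])
     (simp_all add: pd_def)

lemma C1_diff: "C1 \<phi> \<Longrightarrow> C1 \<psi> \<Longrightarrow> C1 (\<lambda>x. \<phi> x - \<psi> x)"
  by (rule C1I[OF has_derivative_diff[OF C1_has_derivative C1_has_derivative]])
     (auto intro!: continuous_intros simp: C1_def pd_def[abs_def])

lemma pd_diff: "C1 \<phi> \<Longrightarrow> C1 \<psi> \<Longrightarrow> pd j (\<lambda>x. \<phi> x - \<psi> x) = (\<lambda>x. pd j \<phi> x - pd j \<psi> x)"
  by (rule ext, subst pd_eqI[OF has_derivative_diff[OF C1_has_derivative C1_has_derivative]])
     (simp_all add: pd_def)

lemma C1_sum: "(\<And>i. i \<in> I \<Longrightarrow> C1 (\<phi> i)) \<Longrightarrow> C1 (\<lambda>x. \<Sum>i\<in>I. \<phi> i x)"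
  by (induction I rule: infinite_finite_induct) (auto intro: C1_const C1_add)

lemma pd_sum:
  "(\<And>i. i \<in> I \<Longrightarrow> C1 (\<phi> i)) \<Longrightarrow> pd j (\<lambda>x. \<Sum>i\<in>I. \<phi> i x) = (\<lambda>x. \<Sum>i\<in>I. pd j (\<phi> i) x)"
  by (induction I rule: infinite_finite_induct) (auto simp: pd_const pd_add C1_sum)

lemma (in bounded_bilinear) C1_bilinear:
  assumes "C1 \<phi>" "C1 \<psi>"
  shows "C1 (\<lambda>x. prod (\<phi> x) (\<psi> x))"
proof (rule C1I[OF FDERIV[OF C1_has_derivative[OF assms(1)] C1_has_derivative[OF assms(2)]]])
  fix j
  show "continuous_on UNIV (\<lambda>x. prod (\<phi> x) (frechet_derivative \<psi> (at x) (axis j 1)) +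
      prod (frechet_derivative \<phi> (at x) (axis j 1)) (\<psi> x))"
    using assms C1_continuous[OF assms(1)] C1_continuous[OF assms(2)]
    by (auto intro!: continuous_on_add continuous_on simp: C1_def pd_def[abs_def])
qed

lemma (in bounded_bilinear) pd_bilinear:
  assumes "C1 \<phi>" "C1 \<psi>"
  shows "pd j (\<lambda>x. prod (\<phi> x) (\<psi> x)) = (\<lambda>x. prod (pd j \<phi> x) (\<psi> x) + prod (\<phi> x) (pd j \<psi> x))"
  by (rule ext, subst pd_eqI[OF FDERIV[OF C1_has_derivative[OF assms(1)] C1_has_derivative[OF assms(2)]]])
     (simp add: pd_def add.commute)

lemmas C1_scaleR = bounded_bilinear.C1_bilinear[OF bounded_bilinear_scaleR]
lemmas pd_scaleR = bounded_bilinear.pd_bilinear[OF bounded_bilinear_scaleR]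
lemmas C1_inner = bounded_bilinear.C1_bilinear[OF bounded_bilinear_inner]
lemmas pd_inner = bounded_bilinear.pd_bilinear[OF bounded_bilinear_inner]

lemma C1_mult: "C1 \<phi> \<Longrightarrow> C1 \<psi> \<Longrightarrow> C1 (\<lambda>x. \<phi> x * \<psi> x)"
  for \<phi> \<psi> :: "_ \<Rightarrow> 'a::real_normed_algebra"
  by (rule bounded_bilinear.C1_bilinear[OF bounded_bilinear_mult])

lemma pd_mult: "C1 \<phi> \<Longrightarrow> C1 \<psi> \<Longrightarrow> pd j (\<lambda>x. \<phi> x * \<psi> x) = (\<lambda>x. pd j \<phi> x * \<psi> x + \<phi> x * pd j \<psi> x)"
  for \<phi> \<psi> :: "_ \<Rightarrow> 'a::real_normed_algebra"
  by (rule bounded_bilinear.pd_bilinear[OF bounded_bilinear_mult])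

lemma C2_scaleR: "C2 \<phi> \<Longrightarrow> C2 \<psi> \<Longrightarrow> C2 (\<lambda>x. \<phi> x *\<^sub>R \<psi> x)"
  unfolding C2_def by (simp add: C1_scaleR pd_scaleR C1_add)

text \<open>A one-sided derivative at \<open>0\<close> is enough because
  \<open>x \<bullet> x\<close> only takes values in \<open>{0..}\<close>. Taking
  \<open>x \<bullet> x\<close> rather than the norm as radial variable avoids the singularity of the
  norm at the origin.\<close>

lemma radial_has_derivative:
  fixes x :: "real^'n::finite"
  assumes "(\<phi> has_real_derivative d) (at (x \<bullet> x) within {0..})"
  shows "((\<lambda>x. \<phi> (x \<bullet> x)) has_derivative (\<lambda>h. 2 * d * (x \<bullet> h))) (at x)"
proof -
  have "((\<lambda>x. x \<bullet> x) has_derivative (\<lambda>h. 2 * (x \<bullet> h))) (at x)"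
    by (auto intro!: derivative_eq_intros simp: inner_commute)
  moreover have "(\<phi> has_derivative (*) d) (at (x \<bullet> x) within range (\<lambda>x::real^'n. x \<bullet> x))"
    using assms unfolding has_field_derivative_def by (rule has_derivative_subset) auto
  ultimately have "((\<lambda>x. \<phi> (x \<bullet> x)) has_derivative (\<lambda>h. d * (2 * (x \<bullet> h)))) (at x)"
    by (rule has_derivative_in_compose)
  then show ?thesis by (simp add: mult_ac)
qed

lemma C1_radial:
  fixes \<phi> :: "real \<Rightarrow> real"
  assumes "\<And>s. s \<ge> 0 \<Longrightarrow> (\<phi> has_real_derivative \<phi>' s) (at s within {0..})"
    and "continuous_on {0..} \<phi>'"
  shows "C1 (\<lambda>x::real^'n::finite. \<phi> (x \<bullet> x))"
proof (rule C1I[where D="\<lambda>x h. 2 * \<phi>' (x \<bullet> x) * (x \<bullet> h)"])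
  show "((\<lambda>x. \<phi> (x \<bullet> x)) has_derivative (\<lambda>h. 2 * \<phi>' (x \<bullet> x) * (x \<bullet> h))) (at x)" for x :: "real^'n"
    by (intro radial_has_derivative assms) simp
  show "continuous_on UNIV (\<lambda>x::real^'n. 2 * \<phi>' (x \<bullet> x) * (x \<bullet> axis j 1))" for j
    by (intro continuous_intros continuous_on_compose2[OF assms(2)]) auto
qed

lemma pd_radial:
  fixes \<phi> :: "real \<Rightarrow> real"
  assumes "\<And>s. s \<ge> 0 \<Longrightarrow> (\<phi> has_real_derivative \<phi>' s) (at s within {0..})"
  shows "pd j (\<lambda>x::real^'n::finite. \<phi> (x \<bullet> x)) = (\<lambda>x. 2 * \<phi>' (x \<bullet> x) * x $ j)"
  by (rule ext, subst pd_eqI[OF radial_has_derivative[OF assms]]) (simp_all add: inner_axis)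

section \<open>Coordinate lines and the symmetry of second derivatives\<close>

lemma line_has_derivative:
  fixes \<phi> :: "real^'n::finite \<Rightarrow> real"
  assumes "C1 \<phi>"
  shows "((\<lambda>t. \<phi> (x + t *\<^sub>R axis j 1)) has_real_derivative pd j \<phi> (x + t *\<^sub>R axis j 1)) (at t within T)"
proof -
  let ?y = "x + t *\<^sub>R axis j 1"
  have 1: "((\<lambda>t. x + t *\<^sub>R axis j 1) has_derivative (\<lambda>h. h *\<^sub>R axis j 1)) (at t within T)"
    by (auto intro!: derivative_eq_intros)
  have 2: "(\<phi> has_derivative frechet_derivative \<phi> (at ?y)) (at ?y)"
    using assms by (rule C1_has_derivative)
  have "linear (frechet_derivative \<phi> (at ?y))"
    using 2 by (rule has_derivative_linear)
  then show ?thesis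
    using has_derivative_compose[OF 1 2]
    by (simp add: has_field_derivative_def pd_def linear_cmul mult.commute[of _ "frechet_derivative _ _ _"])
qed

lemma line_mvt:
  fixes \<phi> :: "real^'n::finite \<Rightarrow> real"
  assumes "C1 \<phi>" "t > 0"
  obtains \<xi> where "0 < \<xi>" "\<xi> < t" "\<phi> (x + t *\<^sub>R axis j 1) - \<phi> x = t * pd j \<phi> (x + \<xi> *\<^sub>R axis j 1)"
  using MVT2[of 0 t "\<lambda>t. \<phi> (x + t *\<^sub>R axis j 1)" "\<lambda>t. pd j \<phi> (x + t *\<^sub>R axis j 1)"]
    line_has_derivative[OF assms(1)] assms(2) by auto

lemma pd_translate:
  fixes \<phi> :: "real^'n::finite \<Rightarrow> 'b::real_normed_vector"
  assumes "C1 \<phi>"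
  shows "C1 (\<lambda>x. \<phi> (x + c))" "pd j (\<lambda>x. \<phi> (x + c)) = (\<lambda>x. pd j \<phi> (x + c))"
proof -
  have d: "((\<lambda>x. \<phi> (x + c)) has_derivative frechet_derivative \<phi> (at (x + c))) (at x)" for x
  proof -
    have "((\<lambda>x. x + c) has_derivative (\<lambda>h. h)) (at x)"
      by (auto intro!: derivative_eq_intros)
    from has_derivative_compose[OF this C1_has_derivative[OF assms]] show ?thesis .
  qed
  show *: "pd j (\<lambda>x. \<phi> (x + c)) = (\<lambda>x. pd j \<phi> (x + c))" for j
    by (rule ext) (simp add: pd_eqI[OF d] pd_def)
  show "C1 (\<lambda>x. \<phi> (x + c))"
    unfolding C1_def *
    using d by (auto simp: differentiable_def intro!: continuous_on_compose2[OF C1_continuous_pd[OF assms]] continuous_intros)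
qed

text \<open>Two applications of the mean value theorem: along direction \<open>j\<close> to the
  difference in direction \<open>k\<close>, then along \<open>k\<close> to
  \<open>pd j \<phi>\<close>. The left-hand side of the equation is symmetric in \<open>j\<close>
  and \<open>k\<close>, which is what the exchange of derivatives rests on.\<close>

lemma second_difference:
  fixes \<phi> :: "real^'n::finite \<Rightarrow> real"
  assumes "C2 \<phi>" "t > 0"
  obtains y where "norm (y - x) \<le> 2 * t"
    "\<phi> (x + t *\<^sub>R axis j 1 + t *\<^sub>R axis k 1) - \<phi> (x + t *\<^sub>R axis j 1) - \<phi> (x + t *\<^sub>R axis k 1) + \<phi> x
      = t\<^sup>2 * pd k (pd j \<phi>) y"
proof -
  let ?\<psi> = "\<lambda>x. \<phi> (x + t *\<^sub>R axis k 1) - \<phi> x"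
  have C: "C1 \<phi>" "C1 (pd j \<phi>)"
    using assms(1) by (simp_all add: C2_def)
  have \<psi>: "C1 ?\<psi>"
    by (intro C1_diff pd_translate C)
  obtain \<xi> where \<xi>: "0 < \<xi>" "\<xi> < t"
    "?\<psi> (x + t *\<^sub>R axis j 1) - ?\<psi> x = t * pd j ?\<psi> (x + \<xi> *\<^sub>R axis j 1)"
    by (rule line_mvt[OF \<psi> assms(2), of x j])
  obtain \<eta> where \<eta>: "0 < \<eta>" "\<eta> < t"
    "pd j \<phi> (x + \<xi> *\<^sub>R axis j 1 + t *\<^sub>R axis k 1) - pd j \<phi> (x + \<xi> *\<^sub>R axis j 1)
      = t * pd k (pd j \<phi>) (x + \<xi> *\<^sub>R axis j 1 + \<eta> *\<^sub>R axis k 1)"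
    by (rule line_mvt[OF C(2) assms(2), of "x + \<xi> *\<^sub>R axis j 1" k])
  have "pd j ?\<psi> (x + \<xi> *\<^sub>R axis j 1) =
      t * pd k (pd j \<phi>) (x + \<xi> *\<^sub>R axis j 1 + \<eta> *\<^sub>R axis k 1)"
    using \<eta>(3) by (simp add: pd_diff pd_translate C)
  with \<xi>(3) have "\<phi> (x + t *\<^sub>R axis j 1 + t *\<^sub>R axis k 1) - \<phi> (x + t *\<^sub>R axis j 1) - \<phi> (x + t *\<^sub>R axis k 1) + \<phi> x
      = t\<^sup>2 * pd k (pd j \<phi>) (x + \<xi> *\<^sub>R axis j 1 + \<eta> *\<^sub>R axis k 1)"
    by (simp add: power2_eq_square algebra_simps)
  moreover have "norm (x + \<xi> *\<^sub>R axis j 1 + \<eta> *\<^sub>R axis k 1 - x) \<le> 2 * t"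
    using norm_triangle_ineq[of "\<xi> *\<^sub>R axis j (1::real)" "\<eta> *\<^sub>R axis k 1"] \<xi> \<eta> by (simp add: add_ac)
  ultimately show ?thesis using that by blast
qed

text \<open>The symmetric second difference forces the two mixed derivatives to take a common value
  at points arbitrarily close to \<open>x\<close>, and both are continuous there.\<close>

lemma pd_commute_real:
  fixes \<phi> :: "real^'n::finite \<Rightarrow> real"
  assumes "C2 \<phi>"
  shows "pd k (pd j \<phi>) x = pd j (pd k \<phi>) x"
proof -
  have *: "\<exists>y z. norm (y - x) \<le> 2 * t \<and> norm (z - x) \<le> 2 * t \<and> pd k (pd j \<phi>) y = pd j (pd k \<phi>) z"
    if t: "t > 0" for t
  proof -
    obtain y where y: "norm (y - x) \<le> 2 * t" "\<phi> (x + t *\<^sub>R axis j 1 + t *\<^sub>R axis k 1) - \<phi> (x + t *\<^sub>R axis j 1) - \<phi> (x + t *\<^sub>R axis k 1) + \<phi> x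
      = t\<^sup>2 * pd k (pd j \<phi>) y"
      by (rule second_difference[OF assms t])
    obtain z where z: "norm (z - x) \<le> 2 * t" "\<phi> (x + t *\<^sub>R axis k 1 + t *\<^sub>R axis j 1) - \<phi> (x + t *\<^sub>R axis k 1) - \<phi> (x + t *\<^sub>R axis j 1) + \<phi> x
      = t\<^sup>2 * pd j (pd k \<phi>) z"
      by (rule second_difference[OF assms t])
    have "t\<^sup>2 * pd k (pd j \<phi>) y = t\<^sup>2 * pd j (pd k \<phi>) z"
      using y(2) z(2) by (simp add: algebra_simps)
    then show ?thesis using y z t by auto
  qed
  have "isCont (pd k (pd j \<phi>)) x" "isCont (pd j (pd k \<phi>)) x"
    using C2_continuous_pd_pd[OF assms] by (simp_all add: continuous_on_eq_continuous_at)
  then have "\<bar>pd k (pd j \<phi>) x - pd j (pd k \<phi>) x\<bar> \<le> 2 * e" if "e > 0" for e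
  proof -
    obtain d1 where d1: "d1 > 0" "\<And>y. dist y x < d1 \<Longrightarrow> dist (pd k (pd j \<phi>) y) (pd k (pd j \<phi>) x) < e"
      using \<open>isCont (pd k (pd j \<phi>)) x\<close> \<open>e > 0\<close> unfolding continuous_at_eps_delta by blast
    obtain d2 where d2: "d2 > 0" "\<And>y. dist y x < d2 \<Longrightarrow> dist (pd j (pd k \<phi>) y) (pd j (pd k \<phi>) x) < e"
      using \<open>isCont (pd j (pd k \<phi>)) x\<close> \<open>e > 0\<close> unfolding continuous_at_eps_delta by blast
    \<comment> \<open>The points supplied by the second difference lie within \<open>2 * t\<close>
      of \<open>x\<close>, which has to stay below both radii of continuity.\<close>
    define t where "t = min d1 d2 / 4"
    have t: "t > 0" "2 * t < d1" "2 * t < d2"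
      using d1(1) d2(1) by (auto simp: t_def min_def)
    obtain y z where yz: "norm (y - x) \<le> 2 * t" "norm (z - x) \<le> 2 * t" "pd k (pd j \<phi>) y = pd j (pd k \<phi>) z"
      using *[OF t(1)] by blast
    then have "dist y x < d1" "dist z x < d2"
      using t by (auto simp: dist_norm)
    from d1(2)[OF this(1)] d2(2)[OF this(2)] yz(3) show ?thesis
      by (simp add: dist_real_def)
  qed
  \<comment> \<open>With \<open>e\<close> a quarter of a positive gap, the gap would be at most half
    of itself.\<close>
  from this[of "\<bar>pd k (pd j \<phi>) x - pd j (pd k \<phi>) x\<bar> / 4"] show ?thesis by force
qed

text \<open>Pairing with a fixed vector \<open>b\<close> reduces the claim to real-valued functions,
  and the pairings with all \<open>b\<close> determine a vector.\<close>

lemma pd_commute: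
  fixes \<phi> :: "real^'n::finite \<Rightarrow> 'b::real_inner"
  assumes "C2 \<phi>"
  shows "pd k (pd j \<phi>) x = pd j (pd k \<phi>) x"
proof -
  have "pd k (pd j \<phi>) x \<bullet> b = pd j (pd k \<phi>) x \<bullet> b" for b
  proof -
    have "C2 (\<lambda>x. \<phi> x \<bullet> b)"
      using assms by (simp add: C2_def C1_inner pd_inner C1_const pd_const)
    from pd_commute_real[OF this, of k j x] show ?thesis
      using assms by (simp add: C2_def C1_inner pd_inner C1_const pd_const)
  qed
  then show ?thesis
    by (metis vector_eq_rdot)
qed

section \<open>Integrals of derivatives of compactly supported functions\<close>

lemma pd_eq_0_outside:
  assumes "closed S" "\<And>x. x \<notin> S \<Longrightarrow> \<phi> x = 0" "x \<notin> S"
  shows "pd j \<phi> x = 0"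
proof -
  have "(\<phi> has_derivative (\<lambda>h. 0)) (at x)"
    by (rule has_derivative_transform_within_open[where f="\<lambda>x. 0" and s="- S"])
       (use assms in \<open>auto simp: open_Compl\<close>)
  from pd_eqI[OF this] show ?thesis .
qed

lemma integrable_continuous_compact_support:
  fixes \<phi> :: "real^'n::finite \<Rightarrow> 'b::{banach,second_countable_topology}"
  assumes "compact S" "\<And>x. x \<notin> S \<Longrightarrow> \<phi> x = 0" "continuous_on UNIV \<phi>"
  shows "integrable lborel \<phi>"
proof -
  have "integrable lborel (\<lambda>x. indicator S x *\<^sub>R \<phi> x)"
    using borel_integrable_compact[OF assms(1) continuous_on_subset[OF assms(3)]] by simp
  also have "(\<lambda>x. indicator S x *\<^sub>R \<phi> x) = \<phi>"
    using assms(2) by (auto simp: indicator_def)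
  finally show ?thesis .
qed

text \<open>Translation invariance of Lebesgue measure makes every difference quotient of \<open>\<phi>\<close> integrate to zero.\<close>
lemma integral_pd_eq_0:
  fixes \<phi> :: "real^'n::finite \<Rightarrow> real"
  assumes \<phi>: "C1 \<phi>" and S: "compact S" "\<And>x. x \<notin> S \<Longrightarrow> \<phi> x = 0"
  shows "(LINT x|lborel. pd j \<phi> x) = 0"
proof -
  let ?e = "axis j 1 :: real^'n"
  define t where "t n = inverse (real (Suc n))" for n
  define q where "q n x = (\<phi> (x + t n *\<^sub>R ?e) - \<phi> x) / t n" for n x
  have t: "0 < t n" "t n \<le> 1" for n
    by (auto simp: t_def field_simps)
  have int: "integrable lborel \<phi>"
    by (rule integrable_continuous_compact_support[OF S C1_continuous[OF \<phi>]])
  have pd0: "pd j \<phi> x = 0" if "x \<notin> S" for x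
    using pd_eq_0_outside[OF compact_imp_closed[OF S(1)] S(2) that] .
  obtain R where R: "\<And>x. x \<in> S \<Longrightarrow> norm x \<le> R"
    using compact_imp_bounded[OF S(1)] unfolding bounded_iff by blast
  obtain B where B0: "B > 0" and B: "\<And>x. x \<in> S \<Longrightarrow> norm (pd j \<phi> x) \<le> B"
    using compact_imp_bounded[OF compact_continuous_image[OF continuous_on_subset[OF C1_continuous_pd[OF \<phi>]] S(1)], of j]
    unfolding bounded_pos by auto
  have B': "\<bar>pd j \<phi> x\<bar> \<le> B" for x
    using B[of x] pd0[of x] B0 by (cases "x \<in> S") auto
  have tr: "integrable lborel (\<lambda>x. \<phi> (x + c))" "(LINT x|lborel. \<phi> (x + c)) = (LINT x|lborel. \<phi> x)" for c
  proof -
    have m: "\<phi> \<in> borel_measurable borel"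
      using C1_continuous[OF \<phi>] by (rule borel_measurable_continuous_onI)
    show "integrable lborel (\<lambda>x. \<phi> (x + c))"
      using integrable_distr_eq[of "(+) c" lborel borel \<phi>] int m by (simp add: lborel_distr_plus add.commute)
    show "(LINT x|lborel. \<phi> (x + c)) = (LINT x|lborel. \<phi> x)"
      using integral_distr[of "(+) c" lborel borel \<phi>] m by (simp add: lborel_distr_plus add.commute)
  qed
  have q0: "(LINT x|lborel. q n x) = 0" for n
    unfolding q_def using tr int by simp
  have "(\<lambda>n. LINT x|lborel. q n x) \<longlonglongrightarrow> (LINT x|lborel. pd j \<phi> x)"
  \<comment> \<open>The shifts \<open>t n\<close> are at most \<open>1\<close>, so the quotients
    vanish outside the ball of radius \<open>R + 1\<close>; inside it the mean value theorem bounds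
    them by \<open>B\<close>.\<close>
  proof (rule integral_dominated_convergence[where w="\<lambda>x. indicator (cball 0 (R + 1)) x * B"])
    show "pd j \<phi> \<in> borel_measurable lborel"
      using C1_continuous_pd[OF \<phi>] by (simp add: borel_measurable_continuous_onI)
    show "q n \<in> borel_measurable lborel" for n
      unfolding q_def using tr(1) int by (auto intro!: borel_measurable_diff borel_measurable_divide)
    show "integrable lborel (\<lambda>x::real^'n. indicator (cball 0 (R + 1)) x * B)"
      using borel_integrable_compact[of "cball 0 (R + 1)" "\<lambda>x::real^'n. B"] by simp
    show "AE x in lborel. (\<lambda>n. q n x) \<longlonglongrightarrow> pd j \<phi> x"
    proof (rule AE_I2)
      fix x
      have "((\<lambda>h. (\<phi> (x + (0 + h) *\<^sub>R ?e) - \<phi> (x + 0 *\<^sub>R ?e)) / h) \<longlongrightarrow> pd j \<phi> (x + 0 *\<^sub>R ?e)) (at 0)"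
        using line_has_derivative[OF \<phi>, of x j 0 UNIV] unfolding DERIV_def by simp
      moreover have "filterlim t (at 0) sequentially"
        unfolding filterlim_at t_def using LIMSEQ_inverse_real_of_nat by (auto intro!: always_eventually)
      ultimately show "(\<lambda>n. q n x) \<longlonglongrightarrow> pd j \<phi> x"
        using filterlim_compose by (fastforce simp: q_def)
    qed
    show "AE x in lborel. norm (q n x) \<le> indicator (cball 0 (R + 1)) x * B" for n
    proof (rule AE_I2)
      fix x
      show "norm (q n x) \<le> indicator (cball 0 (R + 1)) x * B"
      proof (cases "norm x \<le> R + 1")
        case True
        obtain \<xi> where "\<phi> (x + t n *\<^sub>R ?e) - \<phi> x = t n * pd j \<phi> (x + \<xi> *\<^sub>R ?e)"
          using line_mvt[OF \<phi> t(1)] by metis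
        then have "q n x = pd j \<phi> (x + \<xi> *\<^sub>R ?e)"
          using t(1)[of n] by (simp add: q_def)
        then show ?thesis using True B' by simp
      next
        case False
        have "norm x \<le> norm (x + t n *\<^sub>R ?e) + t n"
          using norm_triangle_ineq4[of "x + t n *\<^sub>R ?e" "t n *\<^sub>R ?e"] t(1)[of n] by simp
        then have "norm (x + t n *\<^sub>R ?e) > R" "norm x > R"
          using False t(2)[of n] by auto
        then have "x \<notin> S" "x + t n *\<^sub>R ?e \<notin> S"
          using R by force+
        then show ?thesis using False S(2) by (simp add: q_def)
      qed
    qed
  qed
  then show ?thesis
    using q0 by (simp add: LIMSEQ_const_iff)
qed

section \<open>Integration by parts and Hardy's inequality\<close>

text \<open>For complex \<open>\<phi>\<close> the real inner product of the plane makes this the sum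
  of the squared moduli of the partial derivatives, with no complex conjugates to carry
  along.\<close>

definition grad_sq :: "(real^'n::finite \<Rightarrow> 'b::real_inner) \<Rightarrow> real^'n \<Rightarrow> real" where
  "grad_sq \<phi> x = (\<Sum>j\<in>UNIV. pd j \<phi> x \<bullet> pd j \<phi> x)"

lemma smooth_imp_C2:
  assumes "smooth u"
  shows "C2 u"
proof -
  have d: "pds js u differentiable (at x)" for js x
    using assms by (simp add: smooth_def)
  have c: "continuous_on UNIV (pds js u)" for js
    using d by (simp add: continuous_at_imp_continuous_on differentiable_imp_continuous_within)
  have "C1 u"
    unfolding C1_def using d[of "[]"] c[of "[_]"] by (simp add: pds_def)
  moreover have "C1 (pd j u)" for j
    unfolding C1_def using d[of "[j]"] c[of "[_, j]"] by (simp add: pds_def)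
  ultimately show ?thesis
    by (simp add: C2_def)
qed

lemma test_fun_C2: "test_fun u \<Longrightarrow> C2 u"
  by (simp add: test_fun_def smooth_imp_C2)

lemma test_fun_support:
  assumes "test_fun u"
  obtains S where "compact S" "\<And>x. x \<notin> S \<Longrightarrow> u x = 0"
proof
  show "compact (closure {x. u x \<noteq> 0})"
    using assms by (simp add: test_fun_def)
  show "u x = 0" if "x \<notin> closure {x. u x \<noteq> 0}" for x
    using that closure_subset[of "{x. u x \<noteq> 0}"] by auto
qed

section \<open>Integration by parts by exhibiting a divergence\<close>

lemma integral_divergence_eq_0:
  fixes X :: "'n::finite \<Rightarrow> real^'n \<Rightarrow> real"
  assumes "\<And>j. C1 (X j)" "compact S" "\<And>j x. x \<notin> S \<Longrightarrow> X j x = 0"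
  shows "integrable lborel (\<lambda>x. \<Sum>j\<in>UNIV. pd j (X j) x)"
    and "(LINT x|lborel. (\<Sum>j\<in>UNIV. pd j (X j) x)) = 0"
proof -
  have "integrable lborel (pd j (X j))" for j
    by (rule integrable_continuous_compact_support[OF assms(2)])
       (use assms in \<open>auto intro!: pd_eq_0_outside compact_imp_closed C1_continuous_pd\<close>)
  then show "integrable lborel (\<lambda>x. \<Sum>j\<in>UNIV. pd j (X j) x)"
    and "(LINT x|lborel. (\<Sum>j\<in>UNIV. pd j (X j) x)) = 0"
    using assms by (simp_all add: integral_pd_eq_0)
qed

text \<open>The common pattern of the integrations by parts that follow: one names a compactly
  supported field \<open>X\<close> and checks a pointwise identity between the integrands.\<close>

lemma integral_add_divergence:
  fixes X :: "'n::finite \<Rightarrow> real^'n \<Rightarrow> real"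
  assumes "\<And>j. C1 (X j)" "compact S" "\<And>j x. x \<notin> S \<Longrightarrow> X j x = 0"
    and "integrable lborel q" "\<And>x. p x = q x + (\<Sum>j\<in>UNIV. pd j (X j) x)"
  shows "(LINT x|lborel. p x) = (LINT x|lborel. q x)"
  using integral_divergence_eq_0[OF assms(1-3)] assms(4,5) by simp

text \<open>Green's identity: the field with components \<open>w \<bullet> pd j w\<close> has
  divergence \<open>grad_sq w + w \<bullet> laplace w\<close>.\<close>

lemma integral_neg_laplace:
  fixes w :: "real^'n::finite \<Rightarrow> 'b::real_inner"
  assumes w: "C2 w" and S: "compact S" "\<And>x. x \<notin> S \<Longrightarrow> w x = 0"
  shows "(LINT x|lborel. - (w x \<bullet> laplace w x)) = (LINT x|lborel. grad_sq w x)"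
proof (rule sym, rule integral_add_divergence[where X="\<lambda>j x. w x \<bullet> pd j w x", OF _ S(1)])
  have C: "C1 w" "\<And>j. C1 (pd j w)"
    using w by (simp_all add: C2_def)
  note [continuous_intros] = C1_continuous[OF C(1)] C2_continuous_pd_pd[OF w]
  show "C1 (\<lambda>x. w x \<bullet> pd j w x)" for j
    by (intro C1_inner C)
  show "w x \<bullet> pd j w x = 0" if "x \<notin> S" for j x
    using that S by simp
  show "integrable lborel (\<lambda>x. - (w x \<bullet> laplace w x))"
    by (rule integrable_continuous_compact_support[OF S(1)])
       (auto simp: S laplace_def intro!: continuous_intros)
  show "grad_sq w x = - (w x \<bullet> laplace w x) + (\<Sum>j\<in>UNIV. pd j (\<lambda>x. w x \<bullet> pd j w x) x)" for x
    by (simp add: grad_sq_def laplace_def pd_inner C sum.distrib inner_sum_right)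
qed

lemma grad_sq_continuous: "C2 w \<Longrightarrow> continuous_on UNIV (grad_sq w)"
  unfolding grad_sq_def by (intro continuous_intros C1_continuous C2_C1_pd)

lemma integrable_grad_sq:
  fixes w :: "real^'n::finite \<Rightarrow> 'b::real_inner"
  assumes w: "C2 w" and S: "compact S" "\<And>x. x \<notin> S \<Longrightarrow> w x = 0"
  shows "integrable lborel (grad_sq w)"
proof (rule integrable_continuous_compact_support[OF S(1)])
  show "grad_sq w x = 0" if "x \<notin> S" for x
    using that by (simp add: grad_sq_def pd_eq_0_outside[OF compact_imp_closed[OF S(1)] S(2)])
qed (rule grad_sq_continuous[OF w])

text \<open>In the expansion of \<open>|grad (g u)|^2\<close>, the cross terms together with
  \<open>|grad g|^2 |u|^2\<close> equal the divergence of \<open>g |u|^2 grad g\<close> minus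
  \<open>g * laplace g * |u|^2\<close>.\<close>

lemma integral_grad_sq_scaleR:
  fixes u :: "real^'n::finite \<Rightarrow> 'b::real_inner"
  assumes u: "C2 u" and g: "C2 g" and S: "compact S" "\<And>x. x \<notin> S \<Longrightarrow> u x = 0"
  shows "(LINT x|lborel. grad_sq (\<lambda>x. g x *\<^sub>R u x) x)
       = (LINT x|lborel. (g x)\<^sup>2 * grad_sq u x - g x * laplace g x * (u x \<bullet> u x))"
proof (rule integral_add_divergence[where X="\<lambda>j x. g x * pd j g x * (u x \<bullet> u x)", OF _ S(1)])
  have C: "C1 u" "\<And>j. C1 (pd j u)" "C1 g" "\<And>j. C1 (pd j g)"
    using u g by (simp_all add: C2_def)
  note [continuous_intros] = C1_continuous[OF C(1)] C1_continuous[OF C(3)]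
    C2_continuous_pd_pd[OF g] grad_sq_continuous[OF u]
  note pd0 = pd_eq_0_outside[OF compact_imp_closed[OF S(1)] S(2)]
  show "C1 (\<lambda>x. g x * pd j g x * (u x \<bullet> u x))" for j
    by (intro C1_mult C1_inner C)
  show "g x * pd j g x * (u x \<bullet> u x) = 0" if "x \<notin> S" for j x
    using that S by simp
  show "integrable lborel (\<lambda>x. (g x)\<^sup>2 * grad_sq u x - g x * laplace g x * (u x \<bullet> u x))"
    by (rule integrable_continuous_compact_support[OF S(1)])
       (auto simp: S laplace_def pd0 grad_sq_def[of u] intro!: continuous_intros C1_continuous[OF C(2)])
  fix x
  have "grad_sq (\<lambda>x. g x *\<^sub>R u x) x
      = (\<Sum>j\<in>UNIV. (g x)\<^sup>2 * (pd j u x \<bullet> pd j u x) + 2 * (g x * pd j g x * (u x \<bullet> pd j u x)) + (pd j g x)\<^sup>2 * (u x \<bullet> u x))"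
    unfolding grad_sq_def
    by (rule sum.cong) (simp_all add: pd_scaleR C inner_add_left inner_add_right inner_commute[of "pd _ u x" "u x"] power2_eq_square algebra_simps)
  moreover have "pd j (\<lambda>x. g x * pd j g x * (u x \<bullet> u x)) x
      = (pd j g x)\<^sup>2 * (u x \<bullet> u x) + g x * (u x \<bullet> u x) * pd j (pd j g) x + 2 * (g x * pd j g x * (u x \<bullet> pd j u x))" for j
    by (simp add: pd_mult pd_inner C C1_mult C1_inner inner_commute[of "pd _ u x" "u x"] power2_eq_square algebra_simps)
  ultimately show "grad_sq (\<lambda>x. g x *\<^sub>R u x) x = (g x)\<^sup>2 * grad_sq u x - g x * laplace g x * (u x \<bullet> u x)
      + (\<Sum>j\<in>UNIV. pd j (\<lambda>x. g x * pd j g x * (u x \<bullet> u x)) x)"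
    by (simp add: grad_sq_def[of u] laplace_def sum.distrib sum_distrib_left sum_distrib_right algebra_simps)
qed

text \<open>The real part of \<open>cnj z * z'\<close> is the real inner product of \<open>z\<close>
  and \<open>z'\<close>, so Green's identity applies to the weighted function. Regularity of the
  weight is a hypothesis here; \<open>C2_jbr_powr\<close> supplies it.\<close>

lemma weighted_form_eq:
  fixes u :: "real^'n::finite \<Rightarrow> complex"
  assumes u: "C2 u" and g: "C2 (\<lambda>x::real^'n. jbr a x powr (- \<sigma>))"
    and S: "compact S" "\<And>x. x \<notin> S \<Longrightarrow> u x = 0"
  shows "weighted_form a \<sigma> u = (LINT x|lborel. grad_sq (\<lambda>x. (jbr a x powr (- \<sigma>)) *\<^sub>R u x) x)"
proof -
  define w where "w = (\<lambda>x. (jbr a x powr (- \<sigma>)) *\<^sub>R u x)"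
  have w: "C2 w" unfolding w_def by (intro C2_scaleR u g)
  have w0: "w x = 0" if "x \<notin> S" for x
    using that S by (simp add: w_def)
  note [continuous_intros] = C1_continuous[OF C2_C1[OF w]] C2_continuous_pd_pd[OF w]
  have "integrable lborel (\<lambda>x. cnj (w x) * (- laplace w x))"
    by (rule integrable_continuous_compact_support[OF S(1)])
       (auto simp: w0 laplace_def intro!: continuous_intros)
  then have "Re (l2inner w (\<lambda>x. - laplace w x)) = (LINT x|lborel. Re (cnj (w x) * (- laplace w x)))"
    unfolding l2inner_def by (rule integral_Re[symmetric])
  also have "\<dots> = (LINT x|lborel. - (w x \<bullet> laplace w x))"
    by (simp add: inner_complex_def)
  also have "\<dots> = (LINT x|lborel. grad_sq w x)"
    using integral_neg_laplace[OF w S(1) w0] .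
  finally show ?thesis
    by (simp add: weighted_form_def w_def scaleR_conv_of_real)
qed

text \<open>Completing the square: the sum over \<open>j\<close> of
  \<open>|pd j w + c x_j w / (|x|^2 + \<epsilon>)|^2\<close> is nonnegative, and its cross term is
  integrated by parts. The choice \<open>c = (n - 2) / 2\<close> maximises
  \<open>c (n - 2) - c^2\<close>. The positive \<open>\<epsilon>\<close> makes the field
  \<open>X\<close> differentiable at the origin.\<close>

lemma hardy_regularized:
  fixes w :: "real^'n::finite \<Rightarrow> 'b::real_inner"
  assumes n: "CARD('n) \<ge> 2" and w: "C2 w" and S: "compact S" "\<And>x. x \<notin> S \<Longrightarrow> w x = 0"
    and e: "\<epsilon> > 0"
  shows "((real CARD('n) - 2)\<^sup>2 / 4) * (LINT x|lborel. (x \<bullet> x) / (x \<bullet> x + \<epsilon>)\<^sup>2 * (w x \<bullet> w x))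
     \<le> (LINT x|lborel. grad_sq w x)"
proof -
  define c where "c = (real CARD('n) - 2) / 2"
  have c0: "c \<ge> 0" using n by (simp add: c_def)
  define \<phi> where "\<phi> = (\<lambda>x::real^'n. 1 / (x \<bullet> x + \<epsilon>))"
  define X where "X j x = c * (\<phi> x * x $ j * (w x \<bullet> w x))" for j x
  have C: "C1 w"
    using w by (simp add: C2_def)
  have pos: "x \<bullet> x + \<epsilon> > 0" for x :: "real^'n"
    using e by (simp add: add_nonneg_pos)
  then have nz: "x \<bullet> x + \<epsilon> \<noteq> 0" for x :: "real^'n"
    by (metis less_irrefl)
  have d\<phi>: "((\<lambda>s. 1 / (s + \<epsilon>)) has_real_derivative - (1 / (s + \<epsilon>)\<^sup>2)) (at s within {0..})"
    if "s \<ge> 0" for s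
    using that e by (auto intro!: derivative_eq_intros simp: power2_eq_square)
  have c\<phi>: "continuous_on {0..} (\<lambda>s. - (1 / (s + \<epsilon>)\<^sup>2))"
    using e by (intro continuous_intros) auto
  have C\<phi>: "C1 \<phi>"
    unfolding \<phi>_def by (rule C1_radial[OF d\<phi> c\<phi>])
  have pd\<phi>: "pd j \<phi> = (\<lambda>x. - 2 * (\<phi> x)\<^sup>2 * x $ j)" for j
    unfolding \<phi>_def by (subst pd_radial[OF d\<phi>]) (auto simp: power_divide)
  note [continuous_intros] = C1_continuous[OF C]
  have CX: "C1 (X j)" for j
    unfolding X_def by (intro C1_mult C1_const C\<phi> C1_coord C1_inner C)
  have X0: "X j x = 0" if "x \<notin> S" for j x
    using that S by (simp add: X_def)
  note div = integral_divergence_eq_0[OF CX S(1) X0]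
  have ptw: "c\<^sup>2 * ((x \<bullet> x) / (x \<bullet> x + \<epsilon>)\<^sup>2 * (w x \<bullet> w x)) \<le> grad_sq w x + (\<Sum>j\<in>UNIV. pd j (X j) x)" for x
  proof -
    define p where "p = \<phi> x"
    define s where "s = x \<bullet> x"
    define N where "N = w x \<bullet> w x"
    define E where "E = (\<Sum>j\<in>UNIV. x $ j * (w x \<bullet> pd j w x))"
    have s: "s = (\<Sum>j\<in>UNIV. (x $ j)\<^sup>2)"
      by (simp add: s_def inner_vec_def power2_eq_square)
    have "pd j (X j) x = c * (- 2 * p\<^sup>2 * N * (x $ j)\<^sup>2 + p * N + 2 * p * (x $ j * (w x \<bullet> pd j w x)))" for j
      unfolding X_def
      by (simp add: pd_mult pd_inner pd_const pd_coord pd\<phi> C1_mult C1_const C\<phi> C1_coord C1_inner C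
          inner_commute[of "pd _ w x" "w x"] p_def N_def power2_eq_square algebra_simps)
    then have sum: "(\<Sum>j\<in>UNIV. pd j (X j) x) = c * (- 2 * p\<^sup>2 * N * s + CARD('n) * (p * N) + 2 * p * E)"
      by (simp add: sum.distrib sum_subtractf s E_def flip: sum_distrib_left)
    have "0 \<le> (\<Sum>j\<in>UNIV. (pd j w x + (c * p * x $ j) *\<^sub>R w x) \<bullet> (pd j w x + (c * p * x $ j) *\<^sub>R w x))"
      by (intro sum_nonneg) simp
    also have "\<dots> = (\<Sum>j\<in>UNIV. pd j w x \<bullet> pd j w x + 2 * c * p * (x $ j * (w x \<bullet> pd j w x)) + c\<^sup>2 * p\<^sup>2 * N * (x $ j)\<^sup>2)"
      by (rule sum.cong) (simp_all add: N_def inner_add_left inner_add_right inner_commute[of "pd _ w x" "w x"] power2_eq_square algebra_simps)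
    also have "\<dots> = grad_sq w x + 2 * c * p * E + c\<^sup>2 * p\<^sup>2 * N * s"
      by (simp add: sum.distrib s E_def grad_sq_def flip: sum_distrib_left)
    finally have 1: "0 \<le> grad_sq w x + 2 * c * p * E + c\<^sup>2 * p\<^sup>2 * N * s" .
    have s0: "s \<ge> 0" and N0: "N \<ge> 0" by (simp_all add: s_def N_def)
    have "p = p\<^sup>2 * (s + \<epsilon>)"
      using nz[of x] by (simp add: p_def s_def \<phi>_def power2_eq_square)
    then have "p - p\<^sup>2 * s = p\<^sup>2 * \<epsilon>"
      by (simp add: algebra_simps)
    then have "p\<^sup>2 * s \<le> p"
      using e by (metis diff_ge_0_iff_ge less_imp_le mult_nonneg_nonneg zero_le_power2)
    then have 2: "0 \<le> c * CARD('n) * N * (p - p\<^sup>2 * s)"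
      using c0 N0 by simp
    have c: "real CARD('n) = 2 * c + 2" by (simp add: c_def field_simps)
    \<comment> \<open>With \<open>n = 2 c + 2\<close>, the divergence without its \<open>E\<close>
      term is at least \<open>2 c^2 p^2 s N\<close>; the completed square costs one
      \<open>c^2 p^2 s N\<close> of this.\<close>
    have "c\<^sup>2 * (p\<^sup>2 * s * N) \<le> grad_sq w x + c * (- 2 * p\<^sup>2 * N * s + CARD('n) * (p * N) + 2 * p * E)"
      using 1 2 unfolding c by (simp add: algebra_simps power2_eq_square)
    then show ?thesis
      by (simp add: sum p_def s_def N_def \<phi>_def power_divide)
  qed
  have "integrable lborel (\<lambda>x. (x \<bullet> x) / (x \<bullet> x + \<epsilon>)\<^sup>2 * (w x \<bullet> w x))"
    by (rule integrable_continuous_compact_support[OF S(1)])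
       (auto simp: S nz intro!: continuous_intros)
  then have "(LINT x|lborel. c\<^sup>2 * ((x \<bullet> x) / (x \<bullet> x + \<epsilon>)\<^sup>2 * (w x \<bullet> w x)))
      \<le> (LINT x|lborel. grad_sq w x + (\<Sum>j\<in>UNIV. pd j (X j) x))"
    by (intro integral_mono ptw Bochner_Integration.integrable_add integrable_grad_sq[OF w S] div integrable_mult_right) auto
  also have "\<dots> = (LINT x|lborel. grad_sq w x)"
    using integrable_grad_sq[OF w S] div by simp
  finally show ?thesis
    unfolding c_def by (simp only: integral_mult_right_zero power_divide) simp
qed

text \<open>Any continuous \<open>Q\<close> lying below \<open>1 / |x|^2\<close> away from the
  origin replaces the singular weight; \<open>Q\<close> may change sign. All integrands are then
  continuous with compact support, and the case follows from the regularised inequality by dominated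
  convergence.\<close>

lemma hardy:
  fixes w :: "real^'n::finite \<Rightarrow> 'b::real_inner"
  assumes n: "CARD('n) \<ge> 2" and w: "C2 w" and S: "compact S" "\<And>x. x \<notin> S \<Longrightarrow> w x = 0"
    and Q: "continuous_on UNIV Q" "\<And>x. Q x * (x \<bullet> x) \<le> 1"
  shows "((real CARD('n) - 2)\<^sup>2 / 4) * (LINT x|lborel. Q x * (w x \<bullet> w x)) \<le> (LINT x|lborel. grad_sq w x)"
proof -
  define e where "e n = inverse (real (Suc n))" for n
  have e: "e n > 0" for n by (simp add: e_def)
  have nz: "x \<bullet> x + e n \<noteq> 0" for x :: "real^'n" and n
    using e[of n] inner_ge_zero[of x] by linarith
  \<comment> \<open>The factor \<open>|x|^4 / (|x|^2 + e n)^2\<close> serves twice: the hypothesis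
    on \<open>Q\<close> puts \<open>q n\<close> below the regularised Hardy integrand, and, being at
    most \<open>1\<close>, it makes the limit integrand dominate in absolute value.\<close>
  define q where "q n x = Q x * (x \<bullet> x)\<^sup>2 / (x \<bullet> x + e n)\<^sup>2 * (w x \<bullet> w x)" for n x
  note [continuous_intros] = C1_continuous[OF C2_C1[OF w]] Q(1)
  have q_int: "integrable lborel (q n)" for n
    unfolding q_def by (rule integrable_continuous_compact_support[OF S(1)])
       (auto simp: S nz intro!: continuous_intros)
  have Q_int: "integrable lborel (\<lambda>x. Q x * (w x \<bullet> w x))"
    by (rule integrable_continuous_compact_support[OF S(1)])
       (auto simp: S intro!: continuous_intros)
  have bound: "((real CARD('n) - 2)\<^sup>2 / 4) * (LINT x|lborel. q n x) \<le> (LINT x|lborel. grad_sq w x)" for n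
  proof -
    have "integrable lborel (\<lambda>x. (x \<bullet> x) / (x \<bullet> x + e n)\<^sup>2 * (w x \<bullet> w x))"
      by (rule integrable_continuous_compact_support[OF S(1)])
         (auto simp: S nz intro!: continuous_intros)
    moreover have "q n x \<le> (x \<bullet> x) / (x \<bullet> x + e n)\<^sup>2 * (w x \<bullet> w x)" for x
    proof -
      have "(Q x * (x \<bullet> x)) * ((x \<bullet> x) / (x \<bullet> x + e n)\<^sup>2 * (w x \<bullet> w x)) \<le> 1 * ((x \<bullet> x) / (x \<bullet> x + e n)\<^sup>2 * (w x \<bullet> w x))"
        by (intro mult_right_mono Q(2)) simp
      then show ?thesis by (simp add: q_def power2_eq_square mult_ac)
    qed
    ultimately have "(LINT x|lborel. q n x) \<le> (LINT x|lborel. (x \<bullet> x) / (x \<bullet> x + e n)\<^sup>2 * (w x \<bullet> w x))"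
      by (intro integral_mono q_int)
    then have "((real CARD('n) - 2)\<^sup>2 / 4) * (LINT x|lborel. q n x) \<le>
        ((real CARD('n) - 2)\<^sup>2 / 4) * (LINT x|lborel. (x \<bullet> x) / (x \<bullet> x + e n)\<^sup>2 * (w x \<bullet> w x))"
      by (intro mult_left_mono) auto
    also have "\<dots> \<le> (LINT x|lborel. grad_sq w x)"
      by (rule hardy_regularized[OF n w S e])
    finally show ?thesis .
  qed
  have "(\<lambda>n. LINT x|lborel. q n x) \<longlonglongrightarrow> (LINT x|lborel. Q x * (w x \<bullet> w x))"
  proof (rule integral_dominated_convergence[where w="\<lambda>x. \<bar>Q x * (w x \<bullet> w x)\<bar>"])
    show "(\<lambda>x. Q x * (w x \<bullet> w x)) \<in> borel_measurable lborel" "\<And>n. q n \<in> borel_measurable lborel"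
      using Q_int q_int by blast+
    show "integrable lborel (\<lambda>x. \<bar>Q x * (w x \<bullet> w x)\<bar>)"
      using Q_int by simp
    show "AE x in lborel. norm (q n x) \<le> \<bar>Q x * (w x \<bullet> w x)\<bar>" for n
    proof (rule AE_I2)
      fix x :: "real^'n"
      have "(x \<bullet> x)\<^sup>2 \<le> (x \<bullet> x + e n)\<^sup>2"
        using e[of n] by (intro power_mono) auto
      then have "(x \<bullet> x)\<^sup>2 / (x \<bullet> x + e n)\<^sup>2 \<le> 1"
        by (simp add: divide_le_eq_1)
      then have "((x \<bullet> x)\<^sup>2 / (x \<bullet> x + e n)\<^sup>2) * \<bar>Q x * (w x \<bullet> w x)\<bar> \<le> 1 * \<bar>Q x * (w x \<bullet> w x)\<bar>"
        by (intro mult_right_mono) auto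
      then show "norm (q n x) \<le> \<bar>Q x * (w x \<bullet> w x)\<bar>"
        by (simp add: q_def abs_mult mult_ac)
    qed
    \<comment> \<open>At the origin \<open>q n\<close> is \<open>0\<close> for every
      \<open>n\<close>, whatever the value of \<open>Q\<close> there, so convergence is claimed only
      elsewhere.\<close>
    have "AE x::real^'n in lborel. x \<noteq> 0"
      by (rule AE_lborel_singleton)
    then show "AE x in lborel. (\<lambda>n. q n x) \<longlonglongrightarrow> Q x * (w x \<bullet> w x)"
    proof (rule AE_mp, intro AE_I2 impI)
      fix x :: "real^'n" assume x: "x \<noteq> 0"
      have "e \<longlonglongrightarrow> 0"
        unfolding e_def by (rule LIMSEQ_inverse_real_of_nat)
      then have "(\<lambda>n. q n x) \<longlonglongrightarrow> Q x * (x \<bullet> x)\<^sup>2 / (x \<bullet> x + 0)\<^sup>2 * (w x \<bullet> w x)"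
        unfolding q_def using x by (intro tendsto_intros) auto
      then show "(\<lambda>n. q n x) \<longlonglongrightarrow> Q x * (w x \<bullet> w x)"
        using x by simp
    qed
  qed
  then have "(\<lambda>n. ((real CARD('n) - 2)\<^sup>2 / 4) * (LINT x|lborel. q n x)) \<longlonglongrightarrow>
      ((real CARD('n) - 2)\<^sup>2 / 4) * (LINT x|lborel. Q x * (w x \<bullet> w x))"
    by (rule tendsto_mult_left)
  then show ?thesis
    by (rule LIMSEQ_le_const2) (use bound in blast)
qed

section \<open>The commutator form\<close>

text \<open>The factor \<open>- \<i>\<close> of \<open>gamma0\<close> turns the difference of the
  two conjugate pairings into \<open>- 2 * \<i>\<close> times a real part, and the outer
  \<open>\<i>\<close> makes it real.\<close>

lemma Re_commutator_pairing:
  fixes h A :: "real^'n::finite \<Rightarrow> complex"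
  assumes h: "continuous_on UNIV h" and A: "continuous_on UNIV A"
    and S: "compact S" "\<And>x. x \<notin> S \<Longrightarrow> h x = 0"
  shows "Re (\<i> * (l2inner h (\<lambda>x. - \<i> * A x) - l2inner (\<lambda>x. - \<i> * A x) h))
      = (LINT x|lborel. 2 * (h x \<bullet> A x))"
proof -
  note [continuous_intros] = h A
  have i: "integrable lborel (\<lambda>x. cnj (h x) * (- \<i> * A x))" "integrable lborel (\<lambda>x. cnj (- \<i> * A x) * h x)"
    by (rule integrable_continuous_compact_support[OF S(1)],
        simp add: S, intro continuous_intros)+
  then have "l2inner h (\<lambda>x. - \<i> * A x) - l2inner (\<lambda>x. - \<i> * A x) h
      = (LINT x|lborel. cnj (h x) * (- \<i> * A x) - cnj (- \<i> * A x) * h x)"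
    unfolding l2inner_def by simp
  also have "\<dots> = (LINT x|lborel. (- \<i>) * complex_of_real (2 * (h x \<bullet> A x)))"
    by (rule Bochner_Integration.integral_cong) (simp_all add: complex_eq_iff inner_complex_def algebra_simps)
  also have "\<dots> = - \<i> * complex_of_real (LINT x|lborel. 2 * (h x \<bullet> A x))"
    by (simp only: integral_mult_right_zero integral_complex_of_real)
  finally show ?thesis by simp
qed

text \<open>Up to a divergence, \<open>2 (-\<Delta>u + Vu) \<cdot> (2 b \<cdot> \<nabla>u + (div b) u)\<close> is a quadratic expression
  in \<open>\<nabla>u\<close> and \<open>u\<close> alone.\<close>
lemma virial_identity:
  fixes u :: "real^'n::finite \<Rightarrow> 'b::real_inner" and b :: "'n \<Rightarrow> real^'n \<Rightarrow> real"
  assumes u: "C2 u" and V: "C1 V" and b: "\<And>j. C1 (b j)"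
    and D: "C2 D" "D = (\<lambda>x. \<Sum>j\<in>UNIV. pd j (b j) x)"
    and S: "compact S" "\<And>x. x \<notin> S \<Longrightarrow> u x = 0"
  shows "(LINT x|lborel. 2 * ((- laplace u x + V x *\<^sub>R u x) \<bullet>
            ((\<Sum>k\<in>UNIV. (2 * b k x) *\<^sub>R pd k u x) + D x *\<^sub>R u x)))
    = (LINT x|lborel. 4 * (\<Sum>j\<in>UNIV. \<Sum>k\<in>UNIV. pd j (b k) x * (pd j u x \<bullet> pd k u x))
          - laplace D x * (u x \<bullet> u x) - 2 * (\<Sum>j\<in>UNIV. b j x * pd j V x) * (u x \<bullet> u x))"
proof -
  have C: "C1 u" "\<And>j. C1 (pd j u)" "C1 D" "\<And>j. C1 (pd j D)"
    using u D by (simp_all add: C2_def)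
  note pd0 = pd_eq_0_outside[OF compact_imp_closed[OF S(1)] S(2)]
  note C1s = C1_mult C1_inner C1_scaleR C1_sum C1_const C1_add C1_diff C V b
  note pds = pd_mult pd_inner pd_scaleR pd_sum pd_const pd_add pd_diff
  note [continuous_intros] = C1_continuous[OF C(1)] C1_continuous[OF C(2)]
    C2_continuous_pd_pd[OF D(1)] C1_continuous[OF b] C1_continuous_pd[OF b] C1_continuous_pd[OF V]
  \<comment> \<open>The first two terms come from \<open>-\<Delta>u\<close> against
    \<open>2 b \<cdot> \<nabla>u\<close>, the next two from \<open>-\<Delta>u\<close> against
    \<open>D u\<close>, the last from \<open>V\<close>. The first pair leaves
    \<open>- 2 D |grad u|^2\<close>, which the second pair cancels.\<close>
  define X where "X j x = - 4 * (pd j u x \<bullet> (\<Sum>k\<in>UNIV. b k x *\<^sub>R pd k u x))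
      + 2 * (b j x * (\<Sum>k\<in>UNIV. pd k u x \<bullet> pd k u x)) - 2 * (D x * (pd j u x \<bullet> u x))
      + pd j D x * (u x \<bullet> u x) + 2 * (V x * b j x * (u x \<bullet> u x))" for j x
  show ?thesis
  proof (rule integral_add_divergence[where X=X, OF _ S(1)])
    show "C1 (X j)" for j
      unfolding X_def by (intro C1s)
    show "X j x = 0" if "x \<notin> S" for j x
      using that S pd0 by (simp add: X_def)
    show "integrable lborel (\<lambda>x. 4 * (\<Sum>j\<in>UNIV. \<Sum>k\<in>UNIV. pd j (b k) x * (pd j u x \<bullet> pd k u x))
          - laplace D x * (u x \<bullet> u x) - 2 * (\<Sum>j\<in>UNIV. b j x * pd j V x) * (u x \<bullet> u x))"
      by (rule integrable_continuous_compact_support[OF S(1)], simp add: S pd0,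
          unfold laplace_def, intro continuous_intros)
    fix x
    define P where "P = (\<Sum>k\<in>UNIV. b k x *\<^sub>R pd k u x)"
    define N where "N = (\<Sum>k\<in>UNIV. pd k u x \<bullet> pd k u x)"
    define W where "W = u x \<bullet> u x"
    define E where "E j = (\<Sum>k\<in>UNIV. pd j (b k) x * (pd j u x \<bullet> pd k u x))" for j
    define T where "T j = (\<Sum>k\<in>UNIV. b k x * (pd j u x \<bullet> pd j (pd k u) x))" for j
    define R where "R j = (\<Sum>k\<in>UNIV. b j x * (pd k u x \<bullet> pd j (pd k u) x))" for j
    \<comment> \<open>Exchanging the summation indices and the order of differentiation identifies
      the two sums, so that among second derivatives of \<open>u\<close> only the Laplacian
      survives.\<close>
    have TR: "(\<Sum>j\<in>UNIV. T j) = (\<Sum>j\<in>UNIV. R j)"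
      unfolding T_def R_def by (subst sum.swap) (simp add: pd_commute[OF u])
    have sums: "(\<Sum>j\<in>UNIV. pd j (pd j u) x \<bullet> y) = laplace u x \<bullet> y"
      "(\<Sum>j\<in>UNIV. pd j (b j) x) = D x" "(\<Sum>j\<in>UNIV. pd j (pd j D) x) = laplace D x"
      "(\<Sum>j\<in>UNIV. b j x * (u x \<bullet> pd j u x)) = u x \<bullet> P" for y
      by (simp_all add: laplace_def inner_sum_left inner_sum_right P_def fun_cong[OF D(2)])
    have "pd j (X j) x = - 4 * (pd j (pd j u) x \<bullet> P) - 4 * E j - 4 * T j
        + 2 * N * pd j (b j) x + 4 * R j
        - 2 * D x * (pd j (pd j u) x \<bullet> u x) - 2 * D x * (pd j u x \<bullet> pd j u x)
        + W * pd j (pd j D) x + 2 * W * (b j x * pd j V x) + 2 * V x * W * pd j (b j) x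
        + 4 * V x * (b j x * (u x \<bullet> pd j u x))" for j
      unfolding X_def
      by (simp only: pds C1s)
        (simp add: inner_commute[of "pd _ u x" "u x"] inner_commute[of "pd _ (pd _ u) x" "pd _ u x"]
          inner_sum_right inner_add_right sum.distrib sum_distrib_left sum_negf P_def N_def W_def E_def T_def R_def
          algebra_simps)
    then have "(\<Sum>j\<in>UNIV. pd j (X j) x) = - 4 * (laplace u x \<bullet> P) - 4 * (\<Sum>j\<in>UNIV. E j)
        + 2 * N * D x - 2 * D x * (laplace u x \<bullet> u x) - 2 * D x * N
        + W * laplace D x + 2 * W * (\<Sum>j\<in>UNIV. b j x * pd j V x) + 2 * V x * W * D x
        + 4 * V x * (u x \<bullet> P)"
      using TR
      by (simp add: sum.distrib sum_subtractf sum_negf sums flip: sum_distrib_left N_def)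
    moreover have "(\<Sum>k\<in>UNIV. (2 * b k x) *\<^sub>R pd k u x) = 2 *\<^sub>R P"
      by (simp add: P_def scaleR_sum_right)
    ultimately show "2 * ((- laplace u x + V x *\<^sub>R u x) \<bullet>
            ((\<Sum>k\<in>UNIV. (2 * b k x) *\<^sub>R pd k u x) + D x *\<^sub>R u x))
      = 4 * (\<Sum>j\<in>UNIV. \<Sum>k\<in>UNIV. pd j (b k) x * (pd j u x \<bullet> pd k u x))
          - laplace D x * (u x \<bullet> u x) - 2 * (\<Sum>j\<in>UNIV. b j x * pd j V x) * (u x \<bullet> u x)
          + (\<Sum>j\<in>UNIV. pd j (X j) x)"
      by (simp add: inner_add_left inner_add_right W_def E_def algebra_simps)
  qed
qed

text \<open>With \<open>b\<close> the gradient of \<open>F\<close>, the product rule gives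
  \<open>gamma0 u = - \<i> * A\<close>, where \<open>A = 2 b \<cdot> \<nabla>u + D u\<close> has
  real coefficients; this is the pairing that \<open>virial_identity\<close> evaluates.\<close>

lemma comm_form_eq:
  fixes u :: "real^'n::finite \<Rightarrow> complex" and b :: "'n \<Rightarrow> real^'n \<Rightarrow> real"
  assumes u: "C2 u" and V: "C1 V" and b: "\<And>j. C1 (b j)"
    and F: "\<And>j. pd j (Ffun a \<sigma>) = b j"
    and D: "C2 D" "D = (\<lambda>x. \<Sum>j\<in>UNIV. pd j (b j) x)"
    and S: "compact S" "\<And>x. x \<notin> S \<Longrightarrow> u x = 0"
  shows "comm_form a \<sigma> V u
    = (LINT x|lborel. 4 * (\<Sum>j\<in>UNIV. \<Sum>k\<in>UNIV. pd j (b k) x * (pd j u x \<bullet> pd k u x))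
          - laplace D x * (u x \<bullet> u x) - 2 * (\<Sum>j\<in>UNIV. b j x * pd j V x) * (u x \<bullet> u x))"
proof -
  have C: "C1 u" "\<And>j. C1 (pd j u)"
    using u by (simp_all add: C2_def)
  note pd0 = pd_eq_0_outside[OF compact_imp_closed[OF S(1)]]
  note [continuous_intros] = C1_continuous[OF C(1)] C1_continuous[OF C(2)] C1_continuous[OF V]
    C2_continuous_pd_pd[OF u] C1_continuous[OF C2_C1[OF D(1)]] C1_continuous[OF b]
  define A where "A = (\<lambda>x. (\<Sum>k\<in>UNIV. (2 * b k x) *\<^sub>R pd k u x) + D x *\<^sub>R u x)"
  have gamma: "gamma0 a \<sigma> u = (\<lambda>x. - \<i> * A x)"
  proof
    fix x
    have "pd j (\<lambda>y. complex_of_real (b j y) * u y) x = pd j (b j) x *\<^sub>R u x + b j x *\<^sub>R pd j u x" for j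
      using pd_scaleR[OF b C(1), of j j] by (simp add: scaleR_conv_of_real)
    then show "gamma0 a \<sigma> u x = - \<i> * A x"
      unfolding gamma0_def F A_def D(2)
      by (simp add: scaleR_sum_left scaleR_conv_of_real sum.distrib algebra_simps flip: sum_distrib_left)
  qed
  have H: "Hop V u = (\<lambda>x. - laplace u x + V x *\<^sub>R u x)"
    by (rule ext) (simp add: Hop_def scaleR_conv_of_real)
  have "comm_form a \<sigma> V u = (LINT x|lborel. 2 * ((- laplace u x + V x *\<^sub>R u x) \<bullet> A x))"
    unfolding comm_form_def gamma H
  proof (rule Re_commutator_pairing[OF _ _ S(1)])
    show "continuous_on UNIV (\<lambda>x. - laplace u x + V x *\<^sub>R u x)"
      unfolding laplace_def by (intro continuous_intros)
    show "continuous_on UNIV A"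
      unfolding A_def by (intro continuous_intros)
    show "- laplace u x + V x *\<^sub>R u x = 0" if "x \<notin> S" for x
      using that by (simp add: S laplace_def pd0[OF pd0[OF S(2)]])
  qed
  from trans[OF this[unfolded A_def] virial_identity[OF u V b D S]] show ?thesis .
qed

section \<open>Radial functions and the multiplier\<close>

text \<open>In the variable \<open>s = x \<bullet> x\<close> the radial Laplacian has no
  \<open>1 / r\<close> term, so the formula holds at the origin as well.\<close>

lemma
  fixes \<phi> :: "real \<Rightarrow> real"
  assumes d1: "\<And>s. s \<ge> 0 \<Longrightarrow> (\<phi> has_real_derivative \<phi>1 s) (at s within {0..})"
    and d2: "\<And>s. s \<ge> 0 \<Longrightarrow> (\<phi>1 has_real_derivative \<phi>2 s) (at s within {0..})"
    and c2: "continuous_on {0..} \<phi>2"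
  shows C2_radial: "C2 (\<lambda>x::real^'n::finite. \<phi> (x \<bullet> x))"
    and laplace_radial: "laplace (\<lambda>x::real^'n. \<phi> (x \<bullet> x)) x
        = 2 * real CARD('n) * \<phi>1 (x \<bullet> x) + 4 * (x \<bullet> x) * \<phi>2 (x \<bullet> x)"
proof -
  have c1: "continuous_on {0..} \<phi>1"
    using DERIV_continuous_on[of "{0..}" \<phi>1 \<phi>2] d2 by simp
  have C: "C1 (\<lambda>x::real^'n. \<phi> (x \<bullet> x))" "C1 (\<lambda>x::real^'n. \<phi>1 (x \<bullet> x))"
    by (rule C1_radial[OF d1 c1] C1_radial[OF d2 c2]; assumption)+
  have pd: "pd j (\<lambda>x::real^'n. \<phi> (x \<bullet> x)) = (\<lambda>x. 2 * \<phi>1 (x \<bullet> x) * x $ j)" for j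
    by (rule pd_radial[OF d1])
  have pd1: "pd j (\<lambda>x::real^'n. \<phi>1 (x \<bullet> x)) = (\<lambda>x. 2 * \<phi>2 (x \<bullet> x) * x $ j)" for j
    by (rule pd_radial[OF d2])
  show "C2 (\<lambda>x::real^'n. \<phi> (x \<bullet> x))"
    unfolding C2_def pd by (intro conjI allI C C1_mult C1_const C1_coord)
  have "pd j (pd j (\<lambda>x::real^'n. \<phi> (x \<bullet> x))) x = 2 * \<phi>1 (x \<bullet> x) + 4 * \<phi>2 (x \<bullet> x) * (x $ j)\<^sup>2" for j
    unfolding pd by (simp only: pd_mult C1_mult C1_const C1_coord C pd_const pd_coord pd1) (simp add: power2_eq_square)
  then show "laplace (\<lambda>x::real^'n. \<phi> (x \<bullet> x)) x = 2 * real CARD('n) * \<phi>1 (x \<bullet> x) + 4 * (x \<bullet> x) * \<phi>2 (x \<bullet> x)"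
    by (simp add: laplace_def sum.distrib inner_vec_def power2_eq_square flip: sum_distrib_left)
qed

text \<open>\<open>Jint a (- \<sigma>) 0 (r\<^sup>2)\<close> is \<open>f(r) / r\<close> with the
  integral rescaled to the unit interval. The parameters \<open>\<beta>\<close> and \<open>m\<close>
  make the family closed, up to constant factors, under differentiation in \<open>s\<close>.\<close>

definition Jint :: "real \<Rightarrow> real \<Rightarrow> nat \<Rightarrow> real \<Rightarrow> real" where
  "Jint a \<beta> m s = integral {0..1} (\<lambda>t. t ^ m * (1 + a * s * t\<^sup>2) powr \<beta>)"

lemma Jint_base_pos: "a > 0 \<Longrightarrow> s \<ge> 0 \<Longrightarrow> 1 + a * s * t\<^sup>2 > 0" for a s t :: real
  by (simp add: add_pos_nonneg)

lemma Jint_integrand_continuous: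
  fixes a s \<beta> :: real
  assumes "a > 0" "s \<ge> 0"
  shows "continuous_on T (\<lambda>t. t ^ m * (1 + a * s * t\<^sup>2) powr \<beta>)"
  using Jint_base_pos[OF assms] by (intro continuous_intros) (metis less_irrefl)

lemma Jint_nonneg: "a > 0 \<Longrightarrow> s \<ge> 0 \<Longrightarrow> Jint a \<beta> m s \<ge> 0"
  unfolding Jint_def
  by (intro integral_nonneg integrable_continuous_real Jint_integrand_continuous) auto

text \<open>Differentiation under the integral sign: the \<open>s\<close>-derivative of the
  integrand is jointly continuous, and its inner factor \<open>a * t^2\<close> raises
  \<open>m\<close> by \<open>2\<close>.\<close>

lemma Jint_has_derivative:
  assumes a: "a > 0" and s: "s \<ge> 0"
  shows "(Jint a \<beta> m has_real_derivative a * \<beta> * Jint a (\<beta> - 1) (m + 2) s) (at s within {0..})"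
proof -
  let ?f' = "\<lambda>s t. t ^ m * (\<beta> * (1 + a * s * t\<^sup>2) powr (\<beta> - 1) * (a * t\<^sup>2))"
  have "((\<lambda>s. integral (cbox 0 1) (\<lambda>t. t ^ m * (1 + a * s * t\<^sup>2) powr \<beta>)) has_real_derivative
      integral (cbox 0 1) (?f' s)) (at s within {0..})"
  proof (rule leibniz_rule_field_derivative)
    show "((\<lambda>s. t ^ m * (1 + a * s * t\<^sup>2) powr \<beta>) has_real_derivative ?f' s t) (at s within {0..})"
      if "s \<in> {0..}" for s t
      using Jint_base_pos[OF a, of s t] that
      by (auto intro!: derivative_eq_intros simp: powr_diff)
    show "(\<lambda>t. t ^ m * (1 + a * s * t\<^sup>2) powr \<beta>) integrable_on cbox 0 1" if "s \<in> {0..}" for s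
      using that unfolding cbox_interval
      by (intro integrable_continuous_real Jint_integrand_continuous a) simp
    have "1 + a * s * t\<^sup>2 \<noteq> 0" if "s \<ge> 0" for s t
      using Jint_base_pos[OF a that, of t] by simp
    then show "continuous_on ({0..} \<times> cbox 0 1) (\<lambda>(s, t). ?f' s t)"
      unfolding split_beta by (intro continuous_intros) auto
  qed (use s in auto)
  moreover have "integral (cbox 0 1) (?f' s) = a * \<beta> * Jint a (\<beta> - 1) (m + 2) s"
    unfolding Jint_def cbox_interval integral_mult_right[symmetric]
    by (rule integral_cong) (simp add: power_add power2_eq_square)
  ultimately show ?thesis
    by (simp add: Jint_def[abs_def])
qed

lemma Jint_continuous: "a > 0 \<Longrightarrow> continuous_on {0..} (Jint a \<beta> m)"
  by (rule DERIV_continuous_on[OF Jint_has_derivative]) auto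

text \<open>Integrate the \<open>t\<close>-derivative of \<open>t ^ (m + 1) * (1 + a * s * t\<^sup>2) powr \<beta>\<close>.\<close>
lemma Jint_by_parts:
  assumes a: "a > 0" and s: "s \<ge> 0"
  shows "(real m + 1) * Jint a \<beta> m s + 2 * a * \<beta> * s * Jint a (\<beta> - 1) (m + 2) s = (1 + a * s) powr \<beta>"
proof -
  let ?p = "\<lambda>\<beta> m t. t ^ m * (1 + a * s * t\<^sup>2) powr \<beta>"
  have "((\<lambda>t. (real m + 1) * ?p \<beta> m t + 2 * a * \<beta> * s * ?p (\<beta> - 1) (m + 2) t) has_integral
      (?p \<beta> (m + 1) 1 - ?p \<beta> (m + 1) 0)) {0..1}"
  proof (rule fundamental_theorem_of_calculus)
    fix t :: real
    have "((\<lambda>t. t ^ (m + 1)) has_real_derivative (real m + 1) * t ^ m) (at t within {0..1})"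
      using DERIV_pow[of "m + 1"] by (simp add: add.commute)
    moreover have "((\<lambda>t. (1 + a * s * t\<^sup>2) powr \<beta>) has_real_derivative
        \<beta> * (1 + a * s * t\<^sup>2) powr (\<beta> - 1) * (a * s * (2 * t))) (at t within {0..1})"
      using Jint_base_pos[OF a s, of t]
      by (auto intro!: derivative_eq_intros simp: powr_diff)
    ultimately have "(?p \<beta> (m + 1) has_real_derivative
        (real m + 1) * t ^ m * (1 + a * s * t\<^sup>2) powr \<beta>
          + \<beta> * (1 + a * s * t\<^sup>2) powr (\<beta> - 1) * (a * s * (2 * t)) * t ^ (m + 1)) (at t within {0..1})"
      by (rule DERIV_mult)
    then show "(?p \<beta> (m + 1) has_vector_derivative
        (real m + 1) * ?p \<beta> m t + 2 * a * \<beta> * s * ?p (\<beta> - 1) (m + 2) t) (at t within {0..1})"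
      by (simp add: has_real_derivative_iff_has_vector_derivative algebra_simps power2_eq_square)
  qed simp
  moreover have "((\<lambda>t. (real m + 1) * ?p \<beta> m t + 2 * a * \<beta> * s * ?p (\<beta> - 1) (m + 2) t) has_integral
      ((real m + 1) * Jint a \<beta> m s + 2 * a * \<beta> * s * Jint a (\<beta> - 1) (m + 2) s)) {0..1}"
    unfolding Jint_def
    by (intro has_integral_add has_integral_mult_right integrable_integral integrable_continuous_real
        Jint_integrand_continuous a s)
  ultimately show ?thesis
    by (auto dest: has_integral_unique)
qed

section \<open>Powers of \<open>1 + a s\<close> and the identification of \<open>f\<close> and
  \<open>F\<close>\<close>

lemma powr_affine_has_derivative:
  fixes a s \<beta> :: real
  assumes "a > 0" "s \<ge> 0"
  shows "((\<lambda>s. (1 + a * s) powr \<beta>) has_real_derivative a * \<beta> * (1 + a * s) powr (\<beta> - 1)) (at s within {0..})"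
proof -
  have "1 + a * s > 0" using assms by (simp add: add_pos_nonneg)
  then show ?thesis
    by (auto intro!: derivative_eq_intros simp: powr_diff)
qed

lemma powr_affine_continuous: "a > 0 \<Longrightarrow> continuous_on {0..} (\<lambda>s. (1 + a * s) powr \<beta>)"
  for a \<beta> :: real
  by (rule DERIV_continuous_on[OF powr_affine_has_derivative]) auto

lemma gfun_sq: "a > 0 \<Longrightarrow> (gfun a \<sigma> r)\<^sup>2 = (1 + a * r\<^sup>2) powr (- \<sigma>)"
  by (simp add: gfun_def power2_eq_square flip: powr_add)

text \<open>With \<open>K = Jint a (- \<sigma>) 0\<close>, the derivative of \<open>r K(r^2)\<close>
  is \<open>K + 2 s K'\<close> at \<open>s = r^2\<close>, which \<open>Jint_by_parts\<close> with
  \<open>m = 0\<close> evaluates to \<open>g^2\<close>.\<close>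

lemma ffun_eq:
  assumes a: "a > 0" and r: "r \<ge> 0"
  shows "ffun a \<sigma> r = r * Jint a (- \<sigma>) 0 (r\<^sup>2)"
proof -
  have "((\<lambda>s. (gfun a \<sigma> s)\<^sup>2) has_integral r * Jint a (- \<sigma>) 0 (r\<^sup>2) - 0 * Jint a (- \<sigma>) 0 (0\<^sup>2)) {0..r}"
  proof (rule fundamental_theorem_of_calculus[OF r])
    fix s assume "s \<in> {0..r}"
    have sq: "((\<lambda>s. s\<^sup>2) has_real_derivative 2 * s) (at s within {0..r})"
      by (auto intro!: derivative_eq_intros)
    have "(Jint a (- \<sigma>) 0 has_real_derivative a * (- \<sigma>) * Jint a (- \<sigma> - 1) 2 (s\<^sup>2)) (at (s\<^sup>2) within (\<lambda>s. s\<^sup>2) ` {0..r})"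
      by (rule has_field_derivative_subset[OF Jint_has_derivative[OF a, where m=0, unfolded add_0]]) auto
    from DERIV_image_chain[OF this sq]
    have "((\<lambda>s. s * Jint a (- \<sigma>) 0 (s\<^sup>2)) has_real_derivative
        Jint a (- \<sigma>) 0 (s\<^sup>2) + s * (a * (- \<sigma>) * Jint a (- \<sigma> - 1) 2 (s\<^sup>2) * (2 * s))) (at s within {0..r})"
      by (auto intro!: derivative_eq_intros simp: o_def)
    also have "Jint a (- \<sigma>) 0 (s\<^sup>2) + s * (a * (- \<sigma>) * Jint a (- \<sigma> - 1) 2 (s\<^sup>2) * (2 * s)) = (gfun a \<sigma> s)\<^sup>2"
      using Jint_by_parts[OF a, where s="s\<^sup>2" and m=0 and \<beta>="- \<sigma>", unfolded add_0]
      unfolding gfun_sq[OF a] by (simp add: power2_eq_square algebra_simps)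
    finally show "((\<lambda>s. s * Jint a (- \<sigma>) 0 (s\<^sup>2)) has_vector_derivative (gfun a \<sigma> s)\<^sup>2) (at s within {0..r})"
      by (simp add: has_real_derivative_iff_has_vector_derivative)
  qed
  then show ?thesis
    unfolding ffun_def by (simp add: integral_unique)
qed

text \<open>\<open>F\<close> is a differentiable function \<open>P\<close> of \<open>|x|^2\<close>
  with \<open>P' = K / 2\<close>, because the derivative of \<open>P(r^2)\<close> is
  \<open>r K(r^2) = f(r)\<close>. The gradient is therefore \<open>K x\<close>, at the origin
  too.\<close>

lemma pd_Ffun:
  assumes a: "a > 0"
  shows "pd j (Ffun a \<sigma> :: real^'n::finite \<Rightarrow> real) = (\<lambda>x. Jint a (- \<sigma>) 0 (x \<bullet> x) * x $ j)"
proof -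
  define K where "K = Jint a (- \<sigma>) 0"
  define P where "P s = integral {0..s} (\<lambda>s. K s / 2)" for s
  have K: "continuous_on T K" if "T \<subseteq> {0..}" for T
    unfolding K_def using Jint_continuous[OF a] that by (rule continuous_on_subset)
  have dP: "(P has_real_derivative K s / 2) (at s within {0..})" if "s \<ge> 0" for s
  proof -
    have "(P has_real_derivative K s / 2) (at s within {0..s + 1})"
      unfolding P_def by (rule integral_has_real_derivative) (use that in \<open>auto intro!: continuous_intros K\<close>)
    also have "at s within {0..s + 1} = at s within {0..}"
      \<comment> \<open>The fundamental theorem is stated on a bounded interval; its right end
        \<open>s + 1\<close> lies beyond \<open>s\<close> and does not affect the derivative
        there.\<close>
      by (rule at_within_nhd[where S="{..<s + 1}"]) auto
    finally show ?thesis .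
  qed
  have "Ffun a \<sigma> x = P (x \<bullet> x)" for x :: "real^'n"
  proof -
    have "(ffun a \<sigma> has_integral P ((norm x)\<^sup>2) - P (0\<^sup>2)) {0..norm x}"
    proof (rule fundamental_theorem_of_calculus)
      fix s assume s: "s \<in> {0..norm x}"
      have sq: "((\<lambda>s. s\<^sup>2) has_real_derivative 2 * s) (at s within {0..norm x})"
        by (auto intro!: derivative_eq_intros)
      have "(P has_real_derivative K (s\<^sup>2) / 2) (at (s\<^sup>2) within (\<lambda>s. s\<^sup>2) ` {0..norm x})"
        by (rule has_field_derivative_subset[OF dP]) auto
      from DERIV_image_chain[OF this sq]
      show "((\<lambda>s. P (s\<^sup>2)) has_vector_derivative ffun a \<sigma> s) (at s within {0..norm x})"
        using s by (simp add: ffun_eq[OF a] K_def o_def has_real_derivative_iff_has_vector_derivative mult.commute)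
    qed simp
    then show ?thesis
      unfolding Ffun_def by (simp add: integral_unique P_def power2_norm_eq_inner)
  qed
  then have "(Ffun a \<sigma> :: real^'n \<Rightarrow> real) = (\<lambda>x. P (x \<bullet> x))"
    by auto
  then show ?thesis
    using pd_radial[OF dP, of j] by (simp add: K_def)
qed

lemma jbr_powr: "a > 0 \<Longrightarrow> jbr a x powr p = (1 + a * (x \<bullet> x)) powr (p / 2)"
  by (simp add: jbr_def power2_norm_eq_inner powr_powr add_nonneg_nonneg flip: powr_half_sqrt)

text \<open>Rescaling by \<open>sqrt a\<close> reduces to \<open>a = 1\<close>, where the integral
  of the nonnegative integrand over \<open>{0..sqrt a * r}\<close> is extended to the half-line.
  Convergence at infinity is comparison with \<open>s powr (- 2 * \<sigma>)\<close>, where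
  \<open>\<sigma> > 1/2\<close> enters.\<close>

lemma ffun_le_Msig:
  assumes a: "a > 0" and sig: "\<sigma> > 1/2" and r: "r \<ge> 0"
  shows "ffun a \<sigma> r \<le> Msig \<sigma> / sqrt a"
proof -
  let ?h = "\<lambda>s::real. (1 + s\<^sup>2) powr (- \<sigma>)"
  have pos: "1 + s\<^sup>2 > (0::real)" for s
    by (simp add: add_pos_nonneg)
  then have nz: "1 + s\<^sup>2 \<noteq> (0::real)" for s
    by (metis less_irrefl)
  have cont: "continuous_on T ?h" for T
    by (intro continuous_intros) (simp add: nz)
  have "?h integrable_on {1..}"
  proof (rule measurable_bounded_by_integrable_imp_integrable)
    show "?h \<in> borel_measurable (lebesgue_on {1..})"
      by (rule continuous_imp_measurable_on_sets_lebesgue[OF cont]) simp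
    show "(\<lambda>s. s powr (- 2 * \<sigma>)) integrable_on {1..}"
      using has_integral_powr_to_inf[of "- 2 * \<sigma>" 1] sig by (auto simp: integrable_on_def)
    fix s :: real assume "s \<in> {1..}"
    then have s: "s \<ge> 1" by simp
    then have "s powr 2 \<le> 1 + s\<^sup>2" by (simp add: powr_numeral)
    then have "?h s \<le> (s powr 2) powr (- \<sigma>)"
      using s sig by (intro powr_mono2') auto
    then show "norm (?h s) \<le> s powr (- 2 * \<sigma>)"
      by (simp add: powr_powr)
  qed simp
  moreover have "{0..1} \<inter> {1..} = {1::real}" "{0..1} \<union> {1..} = {0::real..}" by auto
  moreover have "?h integrable_on {0..1}"
    by (intro integrable_continuous_real cont)
  ultimately have int: "?h integrable_on {0..}"
    using integrable_Un[of "{0..1::real}" "{1..}" ?h] by simp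
  then have "set_integrable lebesgue {0..} ?h"
    by (intro nonnegative_absolutely_integrable_1) auto
  then have "(LINT s:{0..}|lebesgue. ?h s) = integral {0..} ?h"
    by (rule set_lebesgue_integral_eq_integral)
  \<comment> \<open>\<open>Msig\<close> is a Lebesgue integral over \<open>lborel\<close> and
    \<open>ffun\<close> a gauge integral; the completed measure connects the two.\<close>
  moreover have "Msig \<sigma> = (LINT s:{0..}|lebesgue. ?h s)"
    unfolding Msig_def set_lebesgue_integral_def
    by (intro integral_completion[symmetric])
       (auto intro!: borel_measurable_continuous_onI borel_measurable_scaleR borel_measurable_indicator cont)
  moreover have "integral {0..sqrt a * r} ?h \<le> integral {0..} ?h"
    by (rule integral_subset_le) (auto intro!: int integrable_continuous_real cont)
  moreover have "integral {0..sqrt a * r} ?h = ffun 1 \<sigma> (sqrt a * r)"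
    unfolding ffun_def by (simp add: gfun_sq)
  \<comment> \<open>\<open>Jint\<close> depends on \<open>a\<close> and \<open>s\<close> only
    through their product, so no change of variables is required.\<close>
  moreover have "ffun 1 \<sigma> (sqrt a * r) = sqrt a * ffun a \<sigma> r"
    using a r by (simp add: ffun_eq Jint_def power_mult_distrib)
  ultimately show ?thesis
    using a by (simp add: field_simps)
qed

section \<open>The lower bound\<close>

lemma
  assumes a: "a > 0"
  shows C2_jbr_powr: "C2 (\<lambda>x::real^'n::finite. jbr a x powr (- \<sigma>))"
    and laplace_jbr_powr: "laplace (\<lambda>x::real^'n. jbr a x powr (- \<sigma>)) x
      = - a * \<sigma> * real CARD('n) * (1 + a * (x \<bullet> x)) powr (- \<sigma> / 2 - 1)
        + a\<^sup>2 * \<sigma> * (\<sigma> + 2) * (x \<bullet> x) * (1 + a * (x \<bullet> x)) powr (- \<sigma> / 2 - 2)"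
proof -
  let ?h1 = "\<lambda>s. a * (- \<sigma> / 2) * (1 + a * s) powr (- \<sigma> / 2 - 1)"
  let ?h2 = "\<lambda>s. a * (- \<sigma> / 2) * (a * (- \<sigma> / 2 - 1) * (1 + a * s) powr (- \<sigma> / 2 - 1 - 1))"
  have d1: "((\<lambda>s. (1 + a * s) powr (- \<sigma> / 2)) has_real_derivative ?h1 s) (at s within {0..})" if "s \<ge> 0" for s
    by (rule powr_affine_has_derivative[OF a that])
  have d2: "(?h1 has_real_derivative ?h2 s) (at s within {0..})" if "s \<ge> 0" for s
    by (rule DERIV_cmult[OF powr_affine_has_derivative[OF a that]])
  have c2: "continuous_on {0..} ?h2"
    by (intro continuous_intros powr_affine_continuous a)
  show "C2 (\<lambda>x::real^'n. jbr a x powr (- \<sigma>))"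
    unfolding jbr_powr[OF a] by (rule C2_radial[OF d1 d2 c2])
  show "laplace (\<lambda>x::real^'n. jbr a x powr (- \<sigma>)) x
      = - a * \<sigma> * real CARD('n) * (1 + a * (x \<bullet> x)) powr (- \<sigma> / 2 - 1)
        + a\<^sup>2 * \<sigma> * (\<sigma> + 2) * (x \<bullet> x) * (1 + a * (x \<bullet> x)) powr (- \<sigma> / 2 - 2)"
    unfolding jbr_powr[OF a]
    by (rule trans[OF laplace_radial[OF d1 d2 c2]]) (simp_all add: power2_eq_square field_simps)
qed

text \<open>Hardy's inequality for \<open>g u\<close> with the weight \<open>Q / g^2\<close>: the
  two factors \<open>g\<close> cancel on the left and the right-hand side is the weighted
  form.\<close>

lemma weighted_hardy:
  fixes u :: "real^'n::finite \<Rightarrow> complex"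
  assumes n: "CARD('n) \<ge> 2" and a: "a > 0" and u: "test_fun u"
    and Q: "continuous_on UNIV Q" "\<And>x. Q x * (x \<bullet> x) \<le> (jbr a x powr (- \<sigma>))\<^sup>2"
  shows "((real CARD('n) - 2)\<^sup>2 / 4) * (LINT x|lborel. Q x * (u x \<bullet> u x)) \<le> weighted_form a \<sigma> u"
proof -
  obtain S where S: "compact S" "\<And>x. x \<notin> S \<Longrightarrow> u x = 0"
    using test_fun_support[OF u] by blast
  let ?g = "\<lambda>x::real^'n. jbr a x powr (- \<sigma>)"
  note g = C2_jbr_powr[OF a, of \<sigma>, where 'n='n]
  have pos: "?g x > 0" for x
  proof -
    have "1 + a * (x \<bullet> x) > 0"
      using a by (simp add: add_pos_nonneg)
    then show ?thesis
      by (simp add: jbr_powr[OF a])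
  qed
  then have nz: "?g x \<noteq> 0" for x
    by (metis less_irrefl)
  have "((real CARD('n) - 2)\<^sup>2 / 4) * (LINT x|lborel. (Q x / (?g x)\<^sup>2) * ((?g x *\<^sub>R u x) \<bullet> (?g x *\<^sub>R u x)))
      \<le> (LINT x|lborel. grad_sq (\<lambda>x. ?g x *\<^sub>R u x) x)"
  proof (rule hardy[OF n _ S(1)])
    show "C2 (\<lambda>x. ?g x *\<^sub>R u x)"
      by (rule C2_scaleR[OF g test_fun_C2[OF u]])
    show "?g x *\<^sub>R u x = 0" if "x \<notin> S" for x
      using that S by simp
    show "continuous_on UNIV (\<lambda>x. Q x / (?g x)\<^sup>2)"
      using nz by (intro continuous_intros Q(1) C1_continuous[OF C2_C1[OF g]]) auto
    show "Q x / (?g x)\<^sup>2 * (x \<bullet> x) \<le> 1" for x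
      using Q(2)[of x] pos[of x] by (simp add: field_simps)
  qed
  also have "(\<lambda>x. (Q x / (?g x)\<^sup>2) * ((?g x *\<^sub>R u x) \<bullet> (?g x *\<^sub>R u x))) = (\<lambda>x. Q x * (u x \<bullet> u x))"
    using nz by (auto simp: power2_eq_square)
  also have "(LINT x|lborel. grad_sq (\<lambda>x. ?g x *\<^sub>R u x) x) = weighted_form a \<sigma> u"
    by (rule weighted_form_eq[OF test_fun_C2[OF u] g S, symmetric])
  finally show ?thesis .
qed

text \<open>Triangle inequality, then Cauchy-Schwarz for real sums. With
  \<open>v j = pd j u x\<close> it bounds \<open>|x \<cdot> \<nabla>u|^2\<close> in the Hessian
  estimate.\<close>

lemma norm_sum_scaleR_sq_le:
  fixes v :: "'n::finite \<Rightarrow> 'b::real_inner" and x :: "real^'n"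
  shows "(\<Sum>j\<in>UNIV. x $ j *\<^sub>R v j) \<bullet> (\<Sum>j\<in>UNIV. x $ j *\<^sub>R v j) \<le> (x \<bullet> x) * (\<Sum>j\<in>UNIV. v j \<bullet> v j)"
proof -
  have "norm (\<Sum>j\<in>UNIV. x $ j *\<^sub>R v j) \<le> (\<Sum>j\<in>UNIV. \<bar>x $ j\<bar> * norm (v j))"
    using norm_sum[of "\<lambda>j. x $ j *\<^sub>R v j" UNIV] by simp
  then have "(norm (\<Sum>j\<in>UNIV. x $ j *\<^sub>R v j))\<^sup>2 \<le> (\<Sum>j\<in>UNIV. \<bar>x $ j\<bar> * norm (v j))\<^sup>2"
    by (intro power_mono) auto
  also have "\<dots> \<le> (\<Sum>j\<in>UNIV. \<bar>x $ j\<bar>\<^sup>2) * (\<Sum>j\<in>UNIV. (norm (v j))\<^sup>2)"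
    by (rule Cauchy_Schwarz_ineq_sum)
  finally show ?thesis
    by (simp add: power2_norm_eq_inner inner_vec_def power2_eq_square flip: power2_norm_eq_inner)
qed

text \<open>The factor \<open>r\<close> of \<open>f(r) = r K(r^2)\<close> cancels the
  \<open>1 / r\<close> in the radial derivative, and at the origin both sides vanish. The right-hand
  side shows that the product is continuous everywhere.\<close>

lemma ffun_radial_dV:
  assumes "a > 0"
  shows "ffun a \<sigma> (norm x) * radial_dV V x = (\<Sum>j\<in>UNIV. Jint a (- \<sigma>) 0 (x \<bullet> x) * x $ j * pd j V x)"
  by (cases "x = 0") (simp_all add: ffun_eq[OF assms] radial_dV_def power2_norm_eq_inner sum_distrib_left mult_ac)

lemma continuous_ffun_radial_dV:
  assumes a: "a > 0" and V: "C1 V"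
  shows "continuous_on UNIV (\<lambda>x. ffun a \<sigma> (norm x) * radial_dV V x)"
  unfolding ffun_radial_dV[OF a]
  by (intro continuous_intros C1_continuous_pd[OF V] continuous_on_compose2[OF Jint_continuous[OF a]]) auto

text \<open>The pointwise lower bound for \<open>4 g \<Delta>g - \<Delta>\<^sup>2F\<close>; with \<open>t = a s\<close> it comes down to
  \<open>8 t (1 - t) \<le> (1 + t)\<^sup>2\<close>, that is \<open>(3 t - 1)\<^sup>2 \<ge> 0\<close>.\<close>
lemma hardy_defect_bound:
  fixes a \<sigma> s n :: real
  assumes a: "a > 0" and \<sigma>: "\<sigma> > 0" and s: "s \<ge> 0" and n: "n \<ge> 3"
  defines "h \<equiv> (1 + a * s) powr (- \<sigma> / 2)"
  defines "h1 \<equiv> (1 + a * s) powr (- \<sigma> / 2 - 1)"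
  defines "h2 \<equiv> (1 + a * s) powr (- \<sigma> / 2 - 2)"
  defines "L1 \<equiv> a * (- \<sigma>) * (1 + a * s) powr (- \<sigma> - 1) + (n - 1) * (a * (- \<sigma>) * Jint a (- \<sigma> - 1) 2 s)"
  defines "L2 \<equiv> a * (- \<sigma>) * (a * (- \<sigma> - 1) * (1 + a * s) powr (- \<sigma> - 1 - 1))
      + (n - 1) * (a * (- \<sigma>) * (a * (- \<sigma> - 1) * Jint a (- \<sigma> - 1 - 1) (2 + 2) s))"
  shows "(2 * n * L1 + 4 * s * L2 - 4 * h * (- a * \<sigma> * n * h1 + a\<^sup>2 * \<sigma> * (\<sigma> + 2) * s * h2)) * s \<le> \<sigma> / 4 * h\<^sup>2"
proof -
  define y where "y = 1 + a * s"
  have y: "y > 0" using a s by (simp add: y_def add_pos_nonneg)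
  have h: "h1 = h / y" "h2 = h / y\<^sup>2"
    using y by (simp_all add: h_def h1_def h2_def powr_diff powr_numeral flip: y_def)
  have G: "(1 + a * s) powr (- \<sigma> - 1) = h\<^sup>2 / y" "(1 + a * s) powr (- \<sigma> - 1 - 1) = h\<^sup>2 / y\<^sup>2"
  proof -
    have "y powr (- \<sigma>) = h\<^sup>2"
      by (simp add: h_def power2_eq_square flip: y_def powr_add)
    then show 1: "(1 + a * s) powr (- \<sigma> - 1) = h\<^sup>2 / y"
      using y by (simp add: powr_diff flip: y_def)
    have "y powr (- \<sigma> - 1 - 1) = y powr (- \<sigma> - 1) / y powr 1"
      by (rule powr_diff)
    then show "(1 + a * s) powr (- \<sigma> - 1 - 1) = h\<^sup>2 / y\<^sup>2"
      using 1 y by (simp add: power2_eq_square flip: y_def)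
  qed
  define J where "J = Jint a (- \<sigma> - 1) 2 s"
  have J0: "J \<ge> 0" unfolding J_def by (rule Jint_nonneg[OF a s])
  define J' where "J' = Jint a (- \<sigma> - 1 - 1) (2 + 2) s"
  \<comment> \<open>Integration by parts eliminates the higher integral \<open>J'\<close>, leaving
    \<open>J\<close> as the only quantity that is not elementary.\<close>
  have "3 * J + 2 * a * (- \<sigma> - 1) * s * J' = h\<^sup>2 / y"
    using Jint_by_parts[OF a s, of 2 "- \<sigma> - 1"] unfolding G(1) by (simp add: J_def J'_def)
  then have J': "2 * a * (- \<sigma> - 1) * s * J' = h\<^sup>2 / y - 3 * J" by simp
  have "4 * s * L2 = 4 * s * (a\<^sup>2 * \<sigma> * (\<sigma> + 1) * h\<^sup>2 / y\<^sup>2) + (n - 1) * (a * (- \<sigma>) * 2) * (2 * a * (- \<sigma> - 1) * s * J')"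
    unfolding L2_def G J'_def[symmetric] by (simp add: algebra_simps power2_eq_square add_divide_distrib)
  then have L2: "4 * s * L2 = 4 * s * (a\<^sup>2 * \<sigma> * (\<sigma> + 1) * h\<^sup>2 / y\<^sup>2) - 2 * (n - 1) * a * \<sigma> * (h\<^sup>2 / y - 3 * J)"
    unfolding J' by simp
  have L1: "L1 = - a * \<sigma> * h\<^sup>2 / y - (n - 1) * a * \<sigma> * J"
    unfolding L1_def G J_def by simp
  have as: "a * s = y - 1" by (simp add: y_def)
  have "2 * n * L1 + 4 * s * L2 - 4 * h * (- a * \<sigma> * n * h1 + a\<^sup>2 * \<sigma> * (\<sigma> + 2) * s * h2)
      = 2 * \<sigma> * a * h\<^sup>2 / y - 4 * (a * s) * a * \<sigma> * h\<^sup>2 / y\<^sup>2 - 2 * (n - 1) * (n - 3) * a * \<sigma> * J"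
    unfolding L1 L2 h by (simp add: algebra_simps power2_eq_square add_divide_distrib diff_divide_distrib)
  also have "\<dots> = a * (2 * \<sigma> * h\<^sup>2 * (2 - y) / y\<^sup>2) - 2 * (n - 1) * (n - 3) * a * \<sigma> * J"
    unfolding as using y by (simp add: field_simps power2_eq_square)
  \<comment> \<open>Here \<open>n \<ge> 3\<close> gives \<open>(n - 1) * (n - 3) \<ge> 0\<close>, so
    the remaining \<open>J\<close> term only helps.\<close>
  also have "\<dots> \<le> a * (2 * \<sigma> * h\<^sup>2 * (2 - y) / y\<^sup>2)"
    using n a \<sigma> J0 by simp
  finally have "(2 * n * L1 + 4 * s * L2 - 4 * h * (- a * \<sigma> * n * h1 + a\<^sup>2 * \<sigma> * (\<sigma> + 2) * s * h2)) * s
      \<le> (a * (2 * \<sigma> * h\<^sup>2 * (2 - y) / y\<^sup>2)) * s"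
    using s by (rule mult_right_mono)
  also have "\<dots> = \<sigma> / 4 * h\<^sup>2 * (8 * (y - 1) * (2 - y) / y\<^sup>2)"
    unfolding as[symmetric] by simp
  also have "\<dots> \<le> \<sigma> / 4 * h\<^sup>2 * 1"
  proof (rule mult_left_mono)
    have "0 \<le> (3 * y - 4)\<^sup>2" by simp
    then have "8 * (y - 1) * (2 - y) \<le> y\<^sup>2" by (simp add: power2_eq_square algebra_simps)
    then show "8 * (y - 1) * (2 - y) / y\<^sup>2 \<le> 1" using y by simp
  qed (use \<sigma> in simp)
  finally show ?thesis by simp
qed

lemma weighted_form_nonneg:
  fixes u :: "real^'n::finite \<Rightarrow> complex"
  assumes a: "a > 0" and u: "test_fun u"
  shows "weighted_form a \<sigma> u \<ge> 0"
proof -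
  obtain S where S: "compact S" "\<And>x. x \<notin> S \<Longrightarrow> u x = 0"
    using test_fun_support[OF u] by blast
  have "weighted_form a \<sigma> u = (LINT x|lborel. grad_sq (\<lambda>x. (jbr a x powr (- \<sigma>)) *\<^sub>R u x) x)"
    by (rule weighted_form_eq[OF test_fun_C2[OF u] C2_jbr_powr[OF a] S])
  then show ?thesis
    by (simp only:, intro integral_nonneg_AE AE_I2) (simp add: grad_sq_def sum_nonneg)
qed

text \<open>The potential is carried along exactly in the \<open>mult_form\<close> term, and only
  the free part is estimated. Either condition on \<open>V\<close> can then be added to this
  inequality.\<close>

lemma comm_form_lower_bound:
  fixes u :: "real^'n::finite \<Rightarrow> complex"
  assumes n: "CARD('n) \<ge> 3" and a: "a > 0" and \<sigma>: "\<sigma> > 0" and V: "C1 V" and u: "test_fun u"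
  shows "comm_form a \<sigma> V u \<ge> (4 - \<sigma> / (real CARD('n) - 2)\<^sup>2) * weighted_form a \<sigma> u
      + mult_form (\<lambda>x. - 2 * ffun a \<sigma> (norm x) * radial_dV V x) u"
proof -
  obtain S where S: "compact S" "\<And>x. x \<notin> S \<Longrightarrow> u x = 0"
    using test_fun_support[OF u] by blast
  note u2 = test_fun_C2[OF u]
  note pd0 = pd_eq_0_outside[OF compact_imp_closed[OF S(1)] S(2)]
  define N where "N = real CARD('n)"
  define g where "g = (\<lambda>x::real^'n. jbr a x powr (- \<sigma>))"
  have g: "C2 g" unfolding g_def by (rule C2_jbr_powr[OF a])
  define K where "K = Jint a (- \<sigma>) 0"
  define K1 where "K1 s = a * (- \<sigma>) * Jint a (- \<sigma> - 1) 2 s" for s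
  define K2 where "K2 s = a * (- \<sigma>) * (a * (- \<sigma> - 1) * Jint a (- \<sigma> - 1 - 1) (2 + 2) s)" for s
  have dK: "(K has_real_derivative K1 s) (at s within {0..})" if "s \<ge> 0" for s
    unfolding K_def K1_def by (rule Jint_has_derivative[OF a that, where m=0, unfolded add_0])
  have dK1: "(K1 has_real_derivative K2 s) (at s within {0..})" if "s \<ge> 0" for s
    unfolding K1_def[abs_def] K2_def by (rule DERIV_cmult[OF Jint_has_derivative[OF a that]])
  have cK1: "continuous_on {0..} K1" and cK2: "continuous_on {0..} K2"
    unfolding K1_def[abs_def] K2_def[abs_def] by (intro continuous_intros Jint_continuous a)+
  \<comment> \<open>The Hessian of \<open>F\<close> is \<open>K\<close> times the identity plus
    \<open>2 K'\<close> times the matrix of entries \<open>x_i x_j\<close>: its eigenvalue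
    tangentially to spheres is \<open>K\<close>, and the radial one is this combination.\<close>
  have KG: "K s + 2 * s * K1 s = (1 + a * s) powr (- \<sigma>)" if "s \<ge> 0" for s
    using Jint_by_parts[OF a that, where m=0 and \<beta>="- \<sigma>", unfolded add_0]
    by (simp add: K_def K1_def mult_ac)
  define b where "b j = (\<lambda>x::real^'n. K (x \<bullet> x) * x $ j)" for j
  have CK: "C1 (\<lambda>x::real^'n. K (x \<bullet> x))"
    by (rule C1_radial[OF dK cK1])
  have pdK: "pd i (\<lambda>x::real^'n. K (x \<bullet> x)) = (\<lambda>x. 2 * K1 (x \<bullet> x) * x $ i)" for i
    by (rule pd_radial[OF dK])
  have b: "C1 (b j)" for j
    unfolding b_def by (intro C1_mult CK C1_coord)
  have pdb: "pd i (b j) x = 2 * K1 (x \<bullet> x) * (x $ i * x $ j) + K (x \<bullet> x) * (if j = i then 1 else 0)" for i j x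
    unfolding b_def by (simp only: pd_mult CK C1_coord pdK pd_coord mult.assoc)
  \<comment> \<open>The Laplacian of \<open>F\<close>, written as the radial eigenvalue plus
    \<open>N - 1\<close> tangential ones.\<close>
  define D where "D = (\<lambda>x::real^'n. (1 + a * (x \<bullet> x)) powr (- \<sigma>) + (N - 1) * K (x \<bullet> x))"
  have D_div: "D = (\<lambda>x. \<Sum>j\<in>UNIV. pd j (b j) x)"
  proof
    fix x :: "real^'n"
    have "(\<Sum>j\<in>UNIV. pd j (b j) x) = 2 * K1 (x \<bullet> x) * (x \<bullet> x) + N * K (x \<bullet> x)"
      by (simp add: pdb sum.distrib N_def inner_vec_def flip: sum_distrib_left)
    then show "D x = (\<Sum>j\<in>UNIV. pd j (b j) x)"
      using KG[of "x \<bullet> x"] by (simp add: D_def algebra_simps)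
  qed
  define L1 where "L1 s = a * (- \<sigma>) * (1 + a * s) powr (- \<sigma> - 1) + (N - 1) * K1 s" for s
  define L2 where "L2 s = a * (- \<sigma>) * (a * (- \<sigma> - 1) * (1 + a * s) powr (- \<sigma> - 1 - 1)) + (N - 1) * K2 s" for s
  have d1: "((\<lambda>s. (1 + a * s) powr (- \<sigma>) + (N - 1) * K s) has_real_derivative L1 s) (at s within {0..})"
    if "s \<ge> 0" for s
    unfolding L1_def by (intro DERIV_add DERIV_cmult powr_affine_has_derivative dK a that)
  have d2: "(L1 has_real_derivative L2 s) (at s within {0..})" if "s \<ge> 0" for s
    unfolding L1_def[abs_def] L2_def by (intro DERIV_add DERIV_cmult powr_affine_has_derivative dK1 a that)
  have c2: "continuous_on {0..} L2"
    unfolding L2_def[abs_def] by (intro continuous_intros cK2 powr_affine_continuous a)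
  have D: "C2 D"
    unfolding D_def by (rule C2_radial[OF d1 d2 c2])
  have lapD: "laplace D x = 2 * N * L1 (x \<bullet> x) + 4 * (x \<bullet> x) * L2 (x \<bullet> x)" for x
    unfolding D_def by (rule trans[OF laplace_radial[OF d1 d2 c2]]) (simp_all add: N_def)
  have F: "pd j (Ffun a \<sigma>) = b j" for j
    unfolding b_def K_def by (rule pd_Ffun[OF a])
  define W where "W x = u x \<bullet> u x" for x
  define R where "R x = - 2 * ffun a \<sigma> (norm x) * radial_dV V x" for x
  have R: "R x = - 2 * (\<Sum>j\<in>UNIV. b j x * pd j V x)" for x
    using ffun_radial_dV[OF a, of \<sigma> x V] by (simp add: R_def b_def K_def)
  note [continuous_intros] = C1_continuous[OF C2_C1[OF u2]] C1_continuous[OF C2_C1_pd[OF u2]]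
    C1_continuous[OF C2_C1[OF g]] C2_continuous_pd_pd[OF g] C2_continuous_pd_pd[OF D]
    grad_sq_continuous[OF u2] C1_continuous[OF b] C1_continuous_pd[OF b] C1_continuous_pd[OF V]
  have cR: "continuous_on UNIV R"
    unfolding R by (intro continuous_intros)
  have clap: "continuous_on UNIV (laplace g)" "continuous_on UNIV (laplace D)"
    unfolding laplace_def[abs_def] by (intro continuous_intros)+
  have cW: "continuous_on UNIV W"
    unfolding W_def by (intro continuous_intros)
  \<comment> \<open>The potential left over once \<open>4 g^2 |grad u|^2\<close> is rewritten
    through the weighted form; Hardy's inequality has to absorb it.\<close>
  define Q where "Q x = laplace D x - 4 * g x * laplace g x" for x
  have cQ: "continuous_on UNIV Q"
    unfolding Q_def by (intro continuous_intros clap)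
  have W0: "W x = 0" if "x \<notin> S" for x using that S by (simp add: W_def)
  have grad0: "grad_sq u x = 0" if "x \<notin> S" for x using that pd0 by (simp add: grad_sq_def)
  have iQ: "integrable lborel (\<lambda>x. Q x * W x)"
    by (rule integrable_continuous_compact_support[OF S(1)]) (auto simp: W0 intro!: continuous_intros cQ cW)
  have iR: "integrable lborel (\<lambda>x. R x * W x)"
    by (rule integrable_continuous_compact_support[OF S(1)]) (auto simp: W0 intro!: continuous_intros cR cW)
  have ig: "integrable lborel (\<lambda>x. (g x)\<^sup>2 * grad_sq u x - g x * laplace g x * W x)"
    by (rule integrable_continuous_compact_support[OF S(1)])
       (auto simp: W0 grad0 intro!: continuous_intros cW clap)
  \<comment> \<open>Since \<open>K1 \<le> 0\<close>, the radial eigenvalue \<open>g^2\<close> is the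
    smaller one; Cauchy-Schwarz for \<open>x \<cdot> \<nabla>u\<close> expresses this without
    diagonalising.\<close>
  have hess: "(\<Sum>j\<in>UNIV. \<Sum>k\<in>UNIV. pd j (b k) x * (pd j u x \<bullet> pd k u x)) \<ge> (g x)\<^sup>2 * grad_sq u x" for x
  proof -
    define s where "s = x \<bullet> x"
    let ?v = "\<Sum>j\<in>UNIV. x $ j *\<^sub>R pd j u x"
    have "(\<Sum>j\<in>UNIV. \<Sum>k\<in>UNIV. pd j (b k) x * (pd j u x \<bullet> pd k u x))
        = (\<Sum>j\<in>UNIV. \<Sum>k\<in>UNIV. 2 * K1 s * (x $ j * (x $ k * (pd k u x \<bullet> pd j u x)))
            + (if k = j then K s * (pd j u x \<bullet> pd k u x) else 0))"
      by (intro sum.cong refl) (simp add: pdb s_def algebra_simps inner_commute)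
    also have "\<dots> = 2 * K1 s * (?v \<bullet> ?v) + K s * grad_sq u x"
      by (simp add: sum.distrib grad_sq_def inner_sum_left inner_sum_right sum_distrib_left mult_ac)
    finally have eq: "(\<Sum>j\<in>UNIV. \<Sum>k\<in>UNIV. pd j (b k) x * (pd j u x \<bullet> pd k u x))
        = 2 * K1 s * (?v \<bullet> ?v) + K s * grad_sq u x" .
    have "Jint a (- \<sigma> - 1) 2 s \<ge> 0"
      by (rule Jint_nonneg[OF a]) (simp add: s_def)
    then have "K1 s \<le> 0"
      using a \<sigma> by (simp add: K1_def)
    moreover have "?v \<bullet> ?v \<le> s * grad_sq u x"
      unfolding s_def grad_sq_def by (rule norm_sum_scaleR_sq_le)
    ultimately have "2 * K1 s * (s * grad_sq u x) \<le> 2 * K1 s * (?v \<bullet> ?v)"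
      by (intro mult_left_mono_neg) auto
    moreover have "(g x)\<^sup>2 = K s + 2 * s * K1 s"
      using KG[of s] by (simp add: g_def jbr_powr[OF a] s_def power2_eq_square flip: powr_add)
    ultimately show ?thesis
      unfolding eq by (simp add: algebra_simps)
  qed
  have wf: "weighted_form a \<sigma> u = (LINT x|lborel. (g x)\<^sup>2 * grad_sq u x - g x * laplace g x * W x)"
    unfolding W_def using weighted_form_eq[OF u2 C2_jbr_powr[OF a] S, of \<sigma>] integral_grad_sq_scaleR[OF u2 g S]
    by (simp add: g_def)
  have mf: "mult_form (\<lambda>x. - 2 * ffun a \<sigma> (norm x) * radial_dV V x) u = (LINT x|lborel. R x * W x)"
    by (simp add: mult_form_def R_def W_def power2_norm_eq_inner)
  have cf: "comm_form a \<sigma> V u = (LINT x|lborel. 4 * (\<Sum>j\<in>UNIV. \<Sum>k\<in>UNIV. pd j (b k) x * (pd j u x \<bullet> pd k u x))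
          - laplace D x * W x + R x * W x)"
    using comm_form_eq[OF u2 V b F D D_div S] by (simp add: W_def R)
  have icf: "integrable lborel (\<lambda>x. 4 * (\<Sum>j\<in>UNIV. \<Sum>k\<in>UNIV. pd j (b k) x * (pd j u x \<bullet> pd k u x))
          - laplace D x * W x + R x * W x)"
    by (rule integrable_continuous_compact_support[OF S(1)])
       (simp add: W0 pd0, intro continuous_intros cW cR clap)
  have "4 * weighted_form a \<sigma> u - (LINT x|lborel. Q x * W x) + (LINT x|lborel. R x * W x)
      = (LINT x|lborel. 4 * ((g x)\<^sup>2 * grad_sq u x - g x * laplace g x * W x) - Q x * W x + R x * W x)"
    unfolding wf using ig iQ iR by (simp del: right_diff_distrib_numeral)
  also have "\<dots> \<le> comm_form a \<sigma> V u"
    unfolding cf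
  proof (rule integral_mono[OF _ icf])
    show "integrable lborel (\<lambda>x. 4 * ((g x)\<^sup>2 * grad_sq u x - g x * laplace g x * W x) - Q x * W x + R x * W x)"
      by (intro ig iQ iR Bochner_Integration.integrable_add Bochner_Integration.integrable_diff integrable_mult_right)
    show "4 * ((g x)\<^sup>2 * grad_sq u x - g x * laplace g x * W x) - Q x * W x + R x * W x
        \<le> 4 * (\<Sum>j\<in>UNIV. \<Sum>k\<in>UNIV. pd j (b k) x * (pd j u x \<bullet> pd k u x)) - laplace D x * W x + R x * W x" for x
      using hess[of x] by (simp add: Q_def algebra_simps)
  qed
  finally have main: "4 * weighted_form a \<sigma> u - (LINT x|lborel. Q x * W x) + (LINT x|lborel. R x * W x)
      \<le> comm_form a \<sigma> V u" .
  \<comment> \<open>The factor \<open>4 / \<sigma>\<close> normalises the bound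
    \<open>Q |x|^2 \<le> (\<sigma> / 4) g^2\<close> of \<open>hardy_defect_bound\<close> to the form
    that \<open>weighted_hardy\<close> asks for.\<close>
  have "(N - 2)\<^sup>2 / 4 * (LINT x|lborel. (4 / \<sigma> * Q x) * (u x \<bullet> u x)) \<le> weighted_form a \<sigma> u"
    unfolding N_def
  proof (rule weighted_hardy[OF _ a u])
    show "continuous_on UNIV (\<lambda>x. 4 / \<sigma> * Q x)"
      by (intro continuous_intros cQ)
    fix x :: "real^'n"
    have "Q x * (x \<bullet> x) \<le> \<sigma> / 4 * (g x)\<^sup>2"
      using hardy_defect_bound[OF a \<sigma>, of "x \<bullet> x" N] n
      unfolding Q_def lapD g_def laplace_jbr_powr[OF a]
      unfolding jbr_powr[OF a] L1_def L2_def K1_def K2_def N_def[symmetric]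
      by (simp add: N_def)
    then show "4 / \<sigma> * Q x * (x \<bullet> x) \<le> (jbr a x powr (- \<sigma>))\<^sup>2"
      using \<sigma> by (simp add: g_def field_simps)
  qed (use n in simp)
  also have "(LINT x|lborel. (4 / \<sigma> * Q x) * (u x \<bullet> u x)) = 4 / \<sigma> * (LINT x|lborel. Q x * W x)"
    unfolding W_def mult.assoc by (rule integral_mult_right_zero)
  finally have "(LINT x|lborel. Q x * W x) \<le> \<sigma> / (N - 2)\<^sup>2 * weighted_form a \<sigma> u"
    using \<sigma> n by (simp add: N_def field_simps)
  with main show ?thesis
    unfolding mf N_def[symmetric] by (simp add: algebra_simps)
qed

section \<open>From the pointwise condition to the form condition\<close>

lemma radial_dV_le: "\<bar>radial_dV V x\<bar> \<le> norm_grad V x"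
proof -
  have "(radial_dV V x)\<^sup>2 \<le> (\<Sum>j\<in>UNIV. (x $ j / norm x)\<^sup>2) * (\<Sum>j\<in>UNIV. (pd j V x)\<^sup>2)"
    unfolding radial_dV_def by (rule Cauchy_Schwarz_ineq_sum)
  also have "(\<Sum>j\<in>UNIV. (x $ j / norm x)\<^sup>2) = (x \<bullet> x) / (norm x)\<^sup>2"
    by (simp add: inner_vec_def power_divide power2_eq_square flip: sum_divide_distrib)
  \<comment> \<open>The quotient is \<open>1\<close> away from the origin and \<open>0\<close> at
    it, where division by zero yields zero.\<close>
  also have "\<dots> * (\<Sum>j\<in>UNIV. (pd j V x)\<^sup>2) \<le> 1 * (\<Sum>j\<in>UNIV. (pd j V x)\<^sup>2)"
    by (intro mult_right_mono sum_nonneg) (auto simp: power2_norm_eq_inner)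
  finally show ?thesis
    unfolding norm_grad_def using real_sqrt_le_mono by fastforce
qed

text \<open>With \<open>c = lam * ((n - 2)^2 - \<sigma> / 4)\<close>, positive by the upper bound on
  \<open>\<sigma>\<close>, the pointwise condition and \<open>f \<le> M / sqrt a\<close> say that
  \<open>2 f \<partial>V/\<partial>r / c\<close> is an admissible weight in
  \<open>weighted_hardy\<close>. The constant that results is \<open>4 c / (n - 2)^2\<close>,
  exactly the one in the form condition.\<close>

lemma pointwise_imp_form_condition:
  fixes V :: "real^'n::finite \<Rightarrow> real"
  assumes n: "CARD('n) \<ge> 3" and a: "a > 0" and sig: "1/2 < \<sigma>" "\<sigma> < 4 * (real CARD('n) - 2)\<^sup>2"
    and V: "C1 V" and lam: "0 < lam" and u: "test_fun u"
    and pt: "\<And>x. x \<noteq> 0 \<Longrightarrow> lam * ((real CARD('n) - 2)\<^sup>2 - \<sigma> / 4) / ((norm x)\<^sup>2 * jbr a x powr (2 * \<sigma>))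
                - 2 * Msig \<sigma> / sqrt a * norm_grad V x \<ge> 0"
  shows "lam * (4 - \<sigma> / (real CARD('n) - 2)\<^sup>2) * weighted_form a \<sigma> u
                + mult_form (\<lambda>x. - 2 * ffun a \<sigma> (norm x) * radial_dV V x) u \<ge> 0"
proof -
  define N where "N = real CARD('n)"
  define c where "c = lam * ((N - 2)\<^sup>2 - \<sigma> / 4)"
  have c: "c > 0"
    using lam sig by (simp add: c_def N_def)
  have N2: "(N - 2)\<^sup>2 > 0"
    using n by (simp add: N_def)
  define R where "R x = 2 * (ffun a \<sigma> (norm x) * radial_dV V x)" for x
  have "(N - 2)\<^sup>2 / 4 * (LINT x|lborel. (1 / c * R x) * (u x \<bullet> u x)) \<le> weighted_form a \<sigma> u"
    unfolding N_def
  proof (rule weighted_hardy[OF _ a u])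
    show "continuous_on UNIV (\<lambda>x. 1 / c * R x)"
      unfolding R_def by (intro continuous_intros continuous_ffun_radial_dV[OF a V])
    fix x :: "real^'n"
    show "1 / c * R x * (x \<bullet> x) \<le> (jbr a x powr (- \<sigma>))\<^sup>2"
    proof (cases "x = 0")
      case False
      have f0: "ffun a \<sigma> (norm x) \<ge> 0"
        using Jint_nonneg[OF a] by (simp add: ffun_eq[OF a])
      have "ffun a \<sigma> (norm x) * radial_dV V x \<le> ffun a \<sigma> (norm x) * norm_grad V x"
        using radial_dV_le[of V x] f0 by (intro mult_left_mono) auto
      also have "\<dots> \<le> Msig \<sigma> / sqrt a * norm_grad V x"
        by (intro mult_right_mono ffun_le_Msig[OF a sig(1)]) (auto simp: norm_grad_def sum_nonneg)
      finally have "R x \<le> 2 * Msig \<sigma> / sqrt a * norm_grad V x"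
        by (simp add: R_def)
      also have "\<dots> \<le> c / ((norm x)\<^sup>2 * jbr a x powr (2 * \<sigma>))"
        using pt[OF False] by (simp add: c_def N_def)
      finally have "R x * (x \<bullet> x) \<le> c / ((norm x)\<^sup>2 * jbr a x powr (2 * \<sigma>)) * (x \<bullet> x)"
        by (intro mult_right_mono) auto
      also have "\<dots> = c * (jbr a x powr (- \<sigma>))\<^sup>2"
      proof -
        have "(jbr a x powr (- \<sigma>))\<^sup>2 = 1 / jbr a x powr (2 * \<sigma>)"
          by (simp add: power2_eq_square powr_minus_divide flip: powr_add)
        then show ?thesis
          using False by (simp add: power2_norm_eq_inner)
      qed
      finally show ?thesis
        using c by (simp add: field_simps)
    qed simp
  qed (use n in simp)
  also have "(LINT x|lborel. (1 / c * R x) * (u x \<bullet> u x)) = 1 / c * (LINT x|lborel. R x * (u x \<bullet> u x))"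
    unfolding mult.assoc by (rule integral_mult_right_zero)
  also have "(LINT x|lborel. R x * (u x \<bullet> u x)) = - mult_form (\<lambda>x. - 2 * ffun a \<sigma> (norm x) * radial_dV V x) u"
    by (simp add: mult_form_def R_def power2_norm_eq_inner mult.assoc)
  finally have "- mult_form (\<lambda>x. - 2 * ffun a \<sigma> (norm x) * radial_dV V x) u
      \<le> 4 * c / (N - 2)\<^sup>2 * weighted_form a \<sigma> u"
    using c N2 by (simp add: field_simps)
  also have "4 * c / (N - 2)\<^sup>2 = lam * (4 - \<sigma> / (N - 2)\<^sup>2)"
    using N2 by (simp add: c_def field_simps)
  finally show ?thesis
    by (simp add: N_def)
qed

theorem theorem7p1:
  fixes V :: "real^'n::finite \<Rightarrow> real" and a \<sigma> lam :: real
  assumes n3: "CARD('n) \<ge> 3"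
    and a: "a > 0"
    and sig: "1/2 < \<sigma>" "\<sigma> < 4 * (real CARD('n) - 2)\<^sup>2"
    and V: "C1_pot V"
    and lam: "0 < lam" "lam < 1"
  shows "((\<forall>u. test_fun u \<longrightarrow>
                lam * (4 - \<sigma> / (real CARD('n) - 2)\<^sup>2) * weighted_form a \<sigma> u
                + mult_form (\<lambda>x. - 2 * ffun a \<sigma> (norm x) * radial_dV V x) u \<ge> 0)
          \<longrightarrow> (\<forall>u. test_fun u \<longrightarrow> comm_form a \<sigma> V u \<ge> 0 \<and>
                 comm_form a \<sigma> V u \<ge> (1 - lam) * (4 - \<sigma> / (real CARD('n) - 2)\<^sup>2) * weighted_form a \<sigma> u))
      \<and> ((\<forall>x. x \<noteq> 0 \<longrightarrow>
                lam * ((real CARD('n) - 2)\<^sup>2 - \<sigma> / 4) / ((norm x)\<^sup>2 * jbr a x powr (2 * \<sigma>))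
                - 2 * Msig \<sigma> / sqrt a * norm_grad V x \<ge> 0)
          \<longrightarrow> (\<forall>u. test_fun u \<longrightarrow> comm_form a \<sigma> V u \<ge> 0 \<and>
                 comm_form a \<sigma> V u \<ge> (1 - lam) * (4 - \<sigma> / (real CARD('n) - 2)\<^sup>2) * weighted_form a \<sigma> u))"
proof -
  have V1: "C1 V"
    using V by (simp add: C1_pot_def C1_def)
  have c: "4 - \<sigma> / (real CARD('n) - 2)\<^sup>2 > 0"
    using n3 sig(2) by (simp add: field_simps)
  \<comment> \<open>Both halves of the theorem go through the form condition at a single
    \<open>u\<close>. Subtracting it from the lower bound leaves the fraction \<open>1 - lam\<close>
    of the weighted form, which is nonnegative because \<open>c\<close> makes the constant
    positive.\<close>
  have concl: "comm_form a \<sigma> V u \<ge> 0 \<and>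
      comm_form a \<sigma> V u \<ge> (1 - lam) * (4 - \<sigma> / (real CARD('n) - 2)\<^sup>2) * weighted_form a \<sigma> u"
    if u: "test_fun u" and form: "lam * (4 - \<sigma> / (real CARD('n) - 2)\<^sup>2) * weighted_form a \<sigma> u
        + mult_form (\<lambda>x. - 2 * ffun a \<sigma> (norm x) * radial_dV V x) u \<ge> 0" for u :: "real^'n \<Rightarrow> complex"
  proof -
    have "comm_form a \<sigma> V u \<ge> (1 - lam) * (4 - \<sigma> / (real CARD('n) - 2)\<^sup>2) * weighted_form a \<sigma> u"
    proof -
      have *: "(1 - lam) * C * w \<le> q" if "C * w + m \<le> q" "0 \<le> lam * C * w + m" for C w m q :: real
        using that by (simp add: algebra_simps)
      show ?thesis
        by (rule *[OF comm_form_lower_bound[OF n3 a _ V1 u] form]) (use sig(1) in simp)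
    qed
    moreover have "(1 - lam) * (4 - \<sigma> / (real CARD('n) - 2)\<^sup>2) * weighted_form a \<sigma> u \<ge> 0"
      using weighted_form_nonneg[OF a u] c lam by simp
    ultimately show ?thesis by linarith
  qed
  show ?thesis
    by (intro conjI impI allI)
       (use concl pointwise_imp_form_condition[OF n3 a sig V1 lam(1)] in blast)+
qed

end
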